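(* Let $X$ be a Banach space, $A:D(A)\subset X\to X$ a Hille-Yosida operator, $X_0=\overline{D(A)}$, and let $F,V:\mathbb R\to\mathcal L(X_0,X)$ be almost periodic (in the operator norm), with the ordered-space conventions given in the context. Assume: (1) there is $\omega\in\mathbb R$ with $(\omega,+\infty)\subset\rho(A)$ and $(\lambda I-A)^{-1}$ is a positive operator for all $\lambda>\omega$; there exists $\lambda_1>\omega_A$ such that $\lambda_1\phi-V(t)\phi\in X_+$ for all $\phi\in X_0^+$, $t\in\mathbb R$; and $F(t)\phi\in X_+$ for all $t\in\mathbb R$, $\phi\in X_0^+$; (2) $\omega(\Gamma)<0$; (3) for any $\epsilon>0$ and $\nu>0$ there exist $\eta=\eta(\epsilon,\nu)>0$ and $\delta=\delta(\epsilon,\nu)<0$ such that $\|\Gamma(t+\tau,s+\tau)-\Gamma(t,s)\|\le\epsilon e^{\delta(t-s)}$ for all $t\ge s$ with $t-s\ge\nu$ and all $\tau\in\mathcal T(V,\eta)$. Then the strongly continuous semigroups $\{T_{(\mathcal B+F)_0}(t)\}_{t\ge0}$ and $\{\mathbb U(t)\}_{t\ge0}$ coincide on $AP(\mathbb R,X_0)$: for any $t\ge0$, $s\in\mathbb R$ and $\phi\in AP(\mathbb R,X_0)$, $$[\mathbb U(t)\phi](s)=[T_{(\mathcal B+F)_0}(t)\phi](s).$$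
   Context: Almost periodicity: for a metric space $(Y,d)$, $f\in C(\mathbb R,Y)$ is almost periodic if for every $\epsilon>0$ the set $\mathcal T(f,\epsilon)=\{\tau\in\mathbb R:d(f(t+\tau),f(t))<\epsilon\ \forall t\in\mathbb R\}$ is relatively dense (there is $l>0$ with $[c,c+l]\cap\mathcal T(f,\epsilon)\ne\emptyset$ for all $c\in\mathbb R$). $AP(\mathbb R,Y)$ is the space of such functions; for $Y$ a Banach space it is a Banach space with the supremum norm. Hille-Yosida operator: a linear operator $A$ (possibly not densely defined) for which there are $\omega_A\in\mathbb R$, $M_A\ge1$ with $(\omega_A,+\infty)\subset\rho(A)$ and $\|(\lambda I-A)^{-n}\|\le M_A(\lambda-\omega_A)^{-n}$ for all $\lambda>\omega_A$, $n\ge1$. The part of an operator in a subspace $Z$ is its restriction to those $\psi\in Z$ in its domain whose image lies in $Z$. Order: $X$ and $X_0$ have normal and generating positive cones $X_+$ and $X_0^+=X_0\cap X_+$. Evolution families: $\{U(t,s)\}_{t\ge s}$ is the exponentially bounded evolution family on $X_0$ such that $u(t)=U(t,t_0)u_0$ is the unique mild (integrated) solution of $u'(t)=Au(t)+F(t)u(t)-V(t)u(t)$, $t>t_0$, $u(t_0)=u_0\in X_0$, i.e. $u\in C([t_0,\infty),X_0)$, $\int_{t_0}^tu(s)ds\in D(A)$ and $u(t)=u_0+A\int_{t_0}^tu(s)ds+\int_{t_0}^t(F(s)-V(s))u(s)ds$. $\{\Gamma(t,s)\}_{t\ge s}$ is the analogous evolution family for $v'(t)=Av(t)-V(t)v(t)$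 (that is, with $F=0$). Exponential growth bound: $\omega(\Gamma)=\inf\{\hat\omega:\exists M\ge1,\ \forall s\in\mathbb R,\ t\ge s:\ \|\Gamma(t,s)\|\le Me^{\hat\omega(t-s)}\}$. Evolution semigroups on $AP(\mathbb R,X_0)$: $[\mathbb U(t)\phi](s)=U(s,s-t)\phi(s-t)$ and $[\mathbb V(t)\phi](s)=\Gamma(s,s-t)\phi(s-t)$, $t\ge0$, $s\in\mathbb R$; both are $C_0$-semigroups. The operator $\mathcal B$: the Hille-Yosida operator $\mathcal B:D(\mathcal B)\subset AP(\mathbb R,X)\to AP(\mathbb R,X)$ with $D(\mathcal B)\subset AP(\mathbb R,X_0)$ characterized by $$((\lambda I-\mathcal B)^{-1}\phi)(t)=\lim_{\mu\to+\infty}\int_{-\infty}^te^{-\lambda(t-s)}\Gamma(t,s)\mu(\mu I-A)^{-1}\phi(s)\,ds,\quad \lambda>\omega(\Gamma),\ \phi\in AP(\mathbb R,X),\ t\in\mathbb R;$$ its part in $AP(\mathbb R,X_0)$ is the generator of $\{\mathbb V(t)\}_{t\ge0}$. $F$ also denotes the bounded multiplication operator $AP(\mathbb R,X_0)\to AP(\mathbb R,X)$, $(F\phi)(s)=F(s)\phi(s)$. $(\mathcal B+F)_0$ is the part of $\mathcal B+F$ (with domain $D(\mathcal B)$) in $AP(\mathbb R,X_0)$; it generates a $C_0$-semigroup $\{T_{(\mathcal B+F)_0}(t)\}_{t\ge0}$ on $AP(\mathbb R,X_0)$. *)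

theory Defs
  imports "HOL-Analysis.Analysis"
begin

section \<open>Bounded linear operators on a subspace\<close>

text \<open>A closed subspace of a Banach space is represented by its carrier set \<open>S\<close>. An element of
  the space of bounded linear operators from \<open>S\<close> to \<open>T\<close> is represented by a function on the
  ambient type; its values outside \<open>S\<close> are irrelevant, and \<open>op_norm S\<close> only looks at \<open>S\<close>.\<close>

definition linear_op :: "'a::real_vector set \<Rightarrow> 'b::real_vector set \<Rightarrow> ('a \<Rightarrow> 'b) \<Rightarrow> bool" where
  "linear_op S T f \<longleftrightarrow> f ` S \<subseteq> T \<and> (\<forall>x\<in>S. \<forall>y\<in>S. f (x + y) = f x + f y) \<and>
     (\<forall>c. \<forall>x\<in>S. f (c *\<^sub>R x) = c *\<^sub>R f x)"

definition bounded_op ::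
  "'a::real_normed_vector set \<Rightarrow> 'b::real_normed_vector set \<Rightarrow> ('a \<Rightarrow> 'b) \<Rightarrow> bool" where
  "bounded_op S T f \<longleftrightarrow> linear_op S T f \<and> (\<exists>K. \<forall>x\<in>S. norm (f x) \<le> K * norm x)"

definition op_norm :: "'a::real_normed_vector set \<Rightarrow> ('a \<Rightarrow> 'b::real_normed_vector) \<Rightarrow> real" where
  "op_norm S f = (SUP x\<in>{x\<in>S. norm x \<le> 1}. norm (f x))"

definition op_dist ::
  "'a::real_normed_vector set \<Rightarrow> ('a \<Rightarrow> 'b::real_normed_vector) \<Rightarrow> ('a \<Rightarrow> 'b) \<Rightarrow> real" where
  "op_dist S f g = op_norm S (\<lambda>x. f x - g x)"


section \<open>Almost periodic functions\<close>

definition relatively_dense :: "real set \<Rightarrow> bool" where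
  "relatively_dense S \<longleftrightarrow> (\<exists>l>0. \<forall>c. {c..c + l} \<inter> S \<noteq> {})"

definition translation_set :: "('y \<Rightarrow> 'y \<Rightarrow> real) \<Rightarrow> (real \<Rightarrow> 'y) \<Rightarrow> real \<Rightarrow> real set" where
  "translation_set d f \<epsilon> = {\<tau>. \<forall>t. d (f (t + \<tau>)) (f t) < \<epsilon>}"

text \<open>The metric is a parameter so that the same definition serves vectors (\<open>dist\<close>) and operators
  on \<open>S\<close> (\<open>op_dist S\<close>, a metric once operators agreeing on \<open>S\<close> are identified). The middle
  conjunct is continuity with respect to \<open>d\<close>.\<close>

definition almost_periodic ::
  "'y set \<Rightarrow> ('y \<Rightarrow> 'y \<Rightarrow> real) \<Rightarrow> (real \<Rightarrow> 'y) \<Rightarrow> bool" where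
  "almost_periodic Y d f \<longleftrightarrow> (\<forall>t. f t \<in> Y) \<and> (\<forall>t. ((\<lambda>s. d (f s) (f t)) \<longlongrightarrow> 0) (at t)) \<and>
     (\<forall>\<epsilon>>0. relatively_dense (translation_set d f \<epsilon>))"

lemma almost_periodic_dist_iff:
  "almost_periodic Y dist f \<longleftrightarrow> range f \<subseteq> Y \<and> continuous_on UNIV f \<and>
     (\<forall>\<epsilon>>0. relatively_dense (translation_set dist f \<epsilon>))"
proof -
  have "(\<forall>t. ((\<lambda>s. dist (f s) (f t)) \<longlongrightarrow> 0) (at t)) \<longleftrightarrow> continuous_on UNIV f"
    by (simp add: continuous_on_def tendsto_dist_iff[symmetric])
  then show ?thesis
    by (auto simp: almost_periodic_def)
qed

lemma almost_periodic_bcontfun: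
  assumes "almost_periodic Y dist f"
  shows "f \<in> bcontfun"
proof -
  have cont: "continuous_on UNIV f"
    using assms by (simp add: almost_periodic_dist_iff)
  have "relatively_dense (translation_set dist f 1)"
    using assms by (simp add: almost_periodic_def)
  then obtain l where l: "l > 0" "\<And>c. {c..c + l} \<inter> translation_set dist f 1 \<noteq> {}"
    unfolding relatively_dense_def by blast
  have "compact (f ` {0..l})"
    using cont by (intro compact_continuous_image) (auto intro: continuous_on_subset)
  then obtain x e where e: "\<And>t. t \<in> {0..l} \<Longrightarrow> dist x (f t) \<le> e"
    using compact_imp_bounded unfolding bounded_def by (metis imageI)
  have "dist x (f t) \<le> e + 1" for t
  proof -
    obtain \<tau> where \<tau>: "\<tau> \<in> {- t..- t + l}" "\<tau> \<in> translation_set dist f 1"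
      using l(2)[of "- t"] by blast
    have "dist x (f (t + \<tau>)) \<le> e" "dist (f (t + \<tau>)) (f t) < 1"
      using \<tau> e[of "t + \<tau>"] by (auto simp: translation_set_def)
    then show ?thesis
      using dist_triangle[of x "f t" "f (t + \<tau>)"] by linarith
  qed
  then have "bounded (range f)"
    unfolding bounded_def by blast
  with cont show ?thesis
    by (simp add: bcontfun_def)
qed

text \<open>The space of almost periodic functions with values in \<open>Y\<close>, as a set of bounded continuous
  functions; by the preceding lemma this loses nothing. The norm of \<open>\<Rightarrow>\<^sub>C\<close> is the supremum norm.\<close>

definition AP :: "'a::metric_space set \<Rightarrow> (real \<Rightarrow>\<^sub>C 'a) set" where
  "AP Y = {\<phi>. almost_periodic Y dist (apply_bcontfun \<phi>)}"


section \<open>Unbounded operators\<close>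

text \<open>An unbounded operator is a pair of a domain \<open>D\<close> and a map \<open>A\<close>, of which only the values
  on \<open>D\<close> matter; \<open>E\<close> is the carrier of the Banach space in which it acts.\<close>

definition resolvent ::
  "'a::real_normed_vector set \<Rightarrow> ('a \<Rightarrow> 'a) \<Rightarrow> real \<Rightarrow> 'a \<Rightarrow> 'a" where
  "resolvent D A \<kappa> = inv_into D (\<lambda>x. \<kappa> *\<^sub>R x - A x)"

definition resolvent_set ::
  "'a::real_normed_vector set \<Rightarrow> 'a set \<Rightarrow> ('a \<Rightarrow> 'a) \<Rightarrow> real set" where
  "resolvent_set E D A =
     {\<kappa>. bij_betw (\<lambda>x. \<kappa> *\<^sub>R x - A x) D E \<and> bounded_op E E (resolvent D A \<kappa>)}"

definition hille_yosida ::
  "'a::real_normed_vector set \<Rightarrow> 'a set \<Rightarrow> ('a \<Rightarrow> 'a) \<Rightarrow> real \<Rightarrow> real \<Rightarrow> bool" where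
  "hille_yosida E D A M \<omega> \<longleftrightarrow> subspace D \<and> D \<subseteq> E \<and> linear_op D E A \<and> M \<ge> 1 \<and>
     (\<forall>\<kappa>>\<omega>. \<kappa> \<in> resolvent_set E D A \<and>
       (\<forall>n\<ge>1. op_norm E (resolvent D A \<kappa> ^^ n) \<le> M / (\<kappa> - \<omega>) ^ n))"

definition part_domain :: "'a set \<Rightarrow> ('a \<Rightarrow> 'a) \<Rightarrow> 'a set \<Rightarrow> 'a set" where
  "part_domain D A Z = {x\<in>D. x \<in> Z \<and> A x \<in> Z}"

definition C0_semigroup ::
  "'a::real_normed_vector set \<Rightarrow> (real \<Rightarrow> 'a \<Rightarrow> 'a) \<Rightarrow> bool" where
  "C0_semigroup E T \<longleftrightarrow> (\<forall>t\<ge>0. bounded_op E E (T t)) \<and> (\<forall>x\<in>E. T 0 x = x) \<and>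
     (\<forall>t\<ge>0. \<forall>s\<ge>0. \<forall>x\<in>E. T (t + s) x = T t (T s x)) \<and>
     (\<forall>x\<in>E. continuous_on {0..} (\<lambda>t. T t x))"

definition is_generator ::
  "'a::real_normed_vector set \<Rightarrow> (real \<Rightarrow> 'a \<Rightarrow> 'a) \<Rightarrow> 'a set \<Rightarrow> ('a \<Rightarrow> 'a) \<Rightarrow> bool" where
  "is_generator E T D A \<longleftrightarrow>
     D = {x\<in>E. \<exists>y\<in>E. ((\<lambda>h. (T h x - x) /\<^sub>R h) \<longlongrightarrow> y) (at_right 0)} \<and>
     (\<forall>x\<in>D. ((\<lambda>h. (T h x - x) /\<^sub>R h) \<longlongrightarrow> A x) (at_right 0))"


section \<open>Positive cones\<close>

definition normal_generating_cone :: "'a::real_normed_vector set \<Rightarrow> 'a set \<Rightarrow> bool" where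
  "normal_generating_cone E P \<longleftrightarrow> P \<subseteq> E \<and> closed P \<and> convex P \<and> cone P \<and> 0 \<in> P \<and>
     (\<forall>x. x \<in> P \<and> - x \<in> P \<longrightarrow> x = 0) \<and>
     (\<exists>N. \<forall>x\<in>P. \<forall>y. y - x \<in> P \<longrightarrow> norm x \<le> N * norm y) \<and>
     (\<forall>x\<in>E. \<exists>p\<in>P. \<exists>q\<in>P. x = p - q)"


section \<open>Evolution families\<close>

definition evolution_family ::
  "'a::real_normed_vector set \<Rightarrow> (real \<Rightarrow> real \<Rightarrow> 'a \<Rightarrow> 'a) \<Rightarrow> bool" where
  "evolution_family E U \<longleftrightarrow> (\<forall>s. \<forall>t\<ge>s. bounded_op E E (U t s)) \<and>
     (\<forall>t. \<forall>x\<in>E. U t t x = x) \<and>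
     (\<forall>s. \<forall>r\<ge>s. \<forall>t\<ge>r. \<forall>x\<in>E. U t s x = U t r (U r s x)) \<and>
     (\<forall>x\<in>E. continuous_on {(t, s). s \<le> t} (\<lambda>(t, s). U t s x))"

definition exponentially_bounded ::
  "'a::real_normed_vector set \<Rightarrow> (real \<Rightarrow> real \<Rightarrow> 'a \<Rightarrow> 'a) \<Rightarrow> real \<Rightarrow> bool" where
  "exponentially_bounded E U \<omega> \<longleftrightarrow>
     (\<exists>M\<ge>1. \<forall>s. \<forall>t\<ge>s. op_norm E (U t s) \<le> M * exp (\<omega> * (t - s)))"

text \<open>Extended real valued, since the infimum may be \<open>-\<infinity>\<close>.\<close>

definition growth_bound ::
  "'a::real_normed_vector set \<Rightarrow> (real \<Rightarrow> real \<Rightarrow> 'a \<Rightarrow> 'a) \<Rightarrow> ereal" where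
  "growth_bound E U = Inf (ereal ` {\<omega>. exponentially_bounded E U \<omega>})"

text \<open>Mild (integrated) solutions on \<open>[t0, \<infinity>)\<close> of \<open>u' = A u + G(t) u\<close>, \<open>u(t0) = u0\<close>. The
  integrands are continuous, so the Henstock-Kurzweil integrals are Riemann integrals.\<close>

definition mild_solution ::
  "'a::banach set \<Rightarrow> ('a \<Rightarrow> 'a) \<Rightarrow> (real \<Rightarrow> 'a \<Rightarrow> 'a) \<Rightarrow> real \<Rightarrow> 'a \<Rightarrow> (real \<Rightarrow> 'a) \<Rightarrow> bool" where
  "mild_solution D A G t0 u0 u \<longleftrightarrow> continuous_on {t0..} u \<and>
     (\<forall>t\<ge>t0. u t \<in> closure D \<and> integral {t0..t} u \<in> D \<and>
       u t = u0 + A (integral {t0..t} u) + integral {t0..t} (\<lambda>s. G s (u s)))"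

definition solution_family ::
  "'a::banach set \<Rightarrow> ('a \<Rightarrow> 'a) \<Rightarrow> (real \<Rightarrow> 'a \<Rightarrow> 'a) \<Rightarrow> (real \<Rightarrow> real \<Rightarrow> 'a \<Rightarrow> 'a) \<Rightarrow> bool" where
  "solution_family D A G U \<longleftrightarrow>
     evolution_family (closure D) U \<and> (\<exists>\<omega>. exponentially_bounded (closure D) U \<omega>) \<and>
     (\<forall>t0. \<forall>u0\<in>closure D. \<forall>u.
        mild_solution D A G t0 u0 u \<longleftrightarrow> (\<forall>t\<ge>t0. u t = U t t0 u0))"

definition evolution_semigroup ::
  "(real \<Rightarrow> real \<Rightarrow> 'a \<Rightarrow> 'a) \<Rightarrow> real \<Rightarrow> (real \<Rightarrow> 'a) \<Rightarrow> real \<Rightarrow> 'a" where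
  "evolution_semigroup U t \<phi> s = U s (s - t) (\<phi> (s - t))"


section \<open>Operators on spaces of almost periodic functions\<close>

text \<open>The operator \<open>\<B>\<close> with domain \<open>DB\<close>, given through its resolvent. For general Banach spaces
  the integral over \<open>{..t}\<close> is the (absolutely convergent) improper integral; the Henstock-Kurzweil
  integral over an unbounded set is the limit over growing compact intervals.\<close>

definition AP_resolvent_operator ::
  "'a::banach set \<Rightarrow> ('a \<Rightarrow> 'a) \<Rightarrow> (real \<Rightarrow> real \<Rightarrow> 'a \<Rightarrow> 'a) \<Rightarrow>
   (real \<Rightarrow>\<^sub>C 'a) set \<Rightarrow> ((real \<Rightarrow>\<^sub>C 'a) \<Rightarrow> (real \<Rightarrow>\<^sub>C 'a)) \<Rightarrow> bool" where
  "AP_resolvent_operator D A \<Gamma> DB B \<longleftrightarrow>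
     (\<exists>M \<omega>. hille_yosida (AP UNIV) DB B M \<omega>) \<and> DB \<subseteq> AP (closure D) \<and>
     (\<forall>\<kappa>. ereal \<kappa> > growth_bound (closure D) \<Gamma> \<longrightarrow>
        \<kappa> \<in> resolvent_set (AP UNIV) DB B \<and>
        (\<forall>\<phi>\<in>AP UNIV. \<forall>t.
           ((\<lambda>\<mu>. integral {..t} (\<lambda>s. exp (- \<kappa> * (t - s)) *\<^sub>R
               \<Gamma> t s (\<mu> *\<^sub>R resolvent D A \<mu> (apply_bcontfun \<phi> s))))
             \<longlongrightarrow> apply_bcontfun (resolvent DB B \<kappa> \<phi>) t) at_top))"

text \<open>For an almost periodic \<open>F\<close> and \<open>\<phi>\<close> with values in the domain of the operators \<open>F s\<close>, the
  function below is bounded and continuous, so that \<open>Bcontfun\<close> is applied to an admissible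
  argument.\<close>

definition mult_op ::
  "(real \<Rightarrow> 'a \<Rightarrow> 'a) \<Rightarrow> (real \<Rightarrow>\<^sub>C 'a::metric_space) \<Rightarrow> (real \<Rightarrow>\<^sub>C 'a)" where
  "mult_op F \<phi> = Bcontfun (\<lambda>s. F s (apply_bcontfun \<phi> s))"

end

theory Submission
  imports Defs
begin

text \<open>Applying a fixed resolvent \<open>R = (\<kappa> - A)\<^sup>-\<^sup>1\<close> turns mild solutions of \<open>u' = A u + G(t) u\<close> into
  solutions of \<open>(R u)' = \<kappa> R u - u + R G(t) u\<close>, in which only bounded operators occur. Since
  \<open>\<omega>(\<Gamma>) < 0\<close>, the resolvent formula for \<open>\<B>\<close> may be used at \<open>0\<close>; approximating
  \<open>\<phi> = - \<B> \<psi>\<close> by \<open>\<mu> (\<mu> - A)\<^sup>-\<^sup>1 \<phi>\<close> it shows that \<open>(R \<psi>)' = \<kappa> R \<psi> - \<psi> - R V \<psi> - R \<B> \<psi>\<close> for all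
  \<open>\<psi>\<close> in the domain of \<open>\<B>\<close>. Now let \<open>\<psi>\<close> be in the domain of \<open>(\<B> + F)\<^sub>0\<close> and put
  \<open>u(t) = [T(t - a) \<psi>](t)\<close>. The derivative of \<open>R u\<close> is the sum of \<open>R (\<B> + F) T(t - a) \<psi>\<close>, from the
  semigroup, and of the above expression, from the argument; \<open>R \<B>\<close> cancels, so \<open>u\<close> is a mild
  solution of the equation for \<open>U\<close> and \<open>u(t) = U(t, a) \<psi>(a)\<close> by uniqueness. The domain of a
  generator is dense, and both sides are continuous in \<open>\<psi>\<close>.\<close>

section \<open>Integrals and one-sided derivatives in Banach spaces\<close>

lemma subspace_closure:
  fixes S :: "'a::real_normed_vector set"
  assumes "subspace S"
  shows "subspace (closure S)"
proof (rule subspaceI)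
  show "0 \<in> closure S"
    using subspace_0[OF assms] closure_subset by blast
next
  fix x y assume "x \<in> closure S" "y \<in> closure S"
  then obtain f g where "\<forall>n. f n \<in> S" "f \<longlonglongrightarrow> x" "\<forall>n. g n \<in> S" "g \<longlonglongrightarrow> y"
    unfolding closure_sequential by blast
  then show "x + y \<in> closure S"
    unfolding closure_sequential
    by (intro exI[of _ "\<lambda>n. f n + g n"]) (auto intro: tendsto_add subspace_add assms)
next
  fix c x assume "x \<in> closure S"
  then obtain f where "\<forall>n. f n \<in> S" "f \<longlonglongrightarrow> x"
    unfolding closure_sequential by blast
  then show "c *\<^sub>R x \<in> closure S"
    unfolding closure_sequential
    by (intro exI[of _ "\<lambda>n. c *\<^sub>R f n"]) (auto intro: tendsto_scaleR subspace_scale assms)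
qed

lemma integral_in_closed_subspace:
  fixes f :: "real \<Rightarrow> 'a::banach"
  assumes S: "subspace S" "closed S" and f: "f integrable_on {a..b}" "\<And>x. x \<in> {a..b} \<Longrightarrow> f x \<in> S"
  shows "integral {a..b} f \<in> S"
proof -
  have "\<exists>y\<in>S. dist y (integral {a..b} f) < e" if "e > 0" for e
  proof -
    have "(f has_integral integral {a..b} f) {a..b}"
      using f(1) by (rule integrable_integral)
    from this[unfolded has_integral_real, rule_format, OF \<open>e > 0\<close>]
    obtain \<gamma> where \<gamma>: "gauge \<gamma> \<and> (\<forall>\<D>. \<D> tagged_division_of {a..b} \<and> \<gamma> fine \<D> \<longrightarrow>
        norm ((\<Sum>(x, k)\<in>\<D>. measure lborel k *\<^sub>R f x) - integral {a..b} f) < e)"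
      by (rule exE)
    obtain \<D> where \<D>: "\<D> tagged_division_of {a..b}" "\<gamma> fine \<D>"
      using fine_division_exists_real[of \<gamma> a b] \<gamma> by (elim conjE) blast
    have "(\<Sum>(x, k)\<in>\<D>. measure lborel k *\<^sub>R f x) \<in> S"
      using f(2) tag_in_interval[OF \<D>(1)]
      by (intro subspace_sum[OF S(1)]) (auto intro!: subspace_scale[OF S(1)])
    then show ?thesis
      using \<gamma> \<D> by (intro bexI[of _ "\<Sum>(x, k)\<in>\<D>. measure lborel k *\<^sub>R f x"]) (simp_all add: dist_norm)
  qed
  then have "integral {a..b} f \<in> closure S"
    by (auto simp: closure_approachable)
  then show ?thesis
    using S(2) by simp
qed

lemma has_vector_derivative_imp_right_quotient:
  fixes f :: "real \<Rightarrow> 'a::real_normed_vector"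
  assumes f: "(f has_vector_derivative D) (at t within {t..b})" and "t < b"
  shows "((\<lambda>h. (f (t + h) - f t) /\<^sub>R h) \<longlongrightarrow> D) (at_right 0)"
proof -
  have "((\<lambda>u. ((f u - f t) - (u - t) *\<^sub>R D) /\<^sub>R norm (u - t)) \<longlongrightarrow> 0) (at t within {t..b})"
    using f by (simp add: has_vector_derivative_def has_derivative_at_within)
  then have "((\<lambda>u. ((f u - f t) - (u - t) *\<^sub>R D) /\<^sub>R norm (u - t)) \<longlongrightarrow> 0) (at_right t)"
    using \<open>t < b\<close> by (simp add: at_within_Icc_at_right)
  then have "((\<lambda>h. ((f (t + h) - f t) - h *\<^sub>R D) /\<^sub>R norm h) \<longlongrightarrow> 0) (at_right 0)"
    by (simp add: filterlim_at_right_to_0[of _ _ t] add.commute)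
  moreover have "eventually (\<lambda>h. ((f (t + h) - f t) - h *\<^sub>R D) /\<^sub>R norm h = (f (t + h) - f t) /\<^sub>R h - D) (at_right 0)"
    using eventually_at_right_less[of "0::real"]
    by eventually_elim (simp add: scaleR_diff_right)
  ultimately have "((\<lambda>h. (f (t + h) - f t) /\<^sub>R h - D) \<longlongrightarrow> 0) (at_right 0)"
    using filterlim_cong by force
  then show ?thesis
    by (simp add: LIM_zero_iff)
qed

lemma right_derivative_imp_integral:
  fixes f g :: "real \<Rightarrow> 'a::banach"
  assumes "a \<le> b" and f: "continuous_on {a..b} f" and g: "continuous_on {a..b} g"
    and deriv: "\<And>t. a \<le> t \<Longrightarrow> t < b \<Longrightarrow> ((\<lambda>h. (f (t + h) - f t) /\<^sub>R h) \<longlongrightarrow> g t) (at_right 0)"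
  shows "f b - f a = integral {a..b} g"
proof -
  define k where "k t = f t - f a - integral {a..t} g" for t
  have k: "continuous_on {a..b} k"
    unfolding k_def
    by (intro continuous_intros f indefinite_integral_continuous_1 integrable_continuous_interval g)
  have k_deriv: "((\<lambda>h. (k (t + h) - k t) /\<^sub>R h) \<longlongrightarrow> 0) (at_right 0)" if t: "a \<le> t" "t < b" for t
  proof -
    have "((\<lambda>u. integral {a..u} g) has_vector_derivative g t) (at t within {a..b})"
      using g t by (intro integral_has_vector_derivative) auto
    then have "((\<lambda>u. integral {a..u} g) has_vector_derivative g t) (at t within {t..b})"
      by (rule has_vector_derivative_within_subset) (use t in auto)
    from has_vector_derivative_imp_right_quotient[OF this t(2)]
    have "((\<lambda>h. (integral {a..t + h} g - integral {a..t} g) /\<^sub>R h) \<longlongrightarrow> g t) (at_right 0)" .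
    from tendsto_diff[OF deriv[OF t] this]
    have "((\<lambda>h. (f (t + h) - f t) /\<^sub>R h - (integral {a..t + h} g - integral {a..t} g) /\<^sub>R h) \<longlongrightarrow> 0) (at_right 0)"
      by simp
    moreover have "(k (t + h) - k t) /\<^sub>R h =
        (f (t + h) - f t) /\<^sub>R h - (integral {a..t + h} g - integral {a..t} g) /\<^sub>R h" for h
      unfolding scaleR_diff_right[symmetric] by (simp add: k_def)
    ultimately show ?thesis by simp
  qed
  have bound: "norm (k b) \<le> e * (b - a)" if "e > 0" for e
  proof -
    define S where "S = {t\<in>{a..b}. norm (k t) \<le> e * (t - a)}"
    define P where "P = {t\<in>{a..b}. {a..t} \<subseteq> S}"
    have "closed S"
      unfolding S_def by (intro continuous_on_closed_Collect_le continuous_intros k)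
    have "a \<in> P"
      using \<open>a \<le> b\<close> by (auto simp: P_def S_def k_def)
    define c where "c = Sup P"
    have bdd: "bdd_above P"
      by (rule bdd_aboveI[of _ b]) (simp add: P_def)
    have c: "a \<le> c" "c \<le> b"
    proof -
      show "a \<le> c"
        unfolding c_def using \<open>a \<in> P\<close> bdd by (rule cSup_upper)
      show "c \<le> b"
        unfolding c_def using \<open>a \<in> P\<close> by (intro cSup_least) (auto simp only: P_def mem_Collect_eq atLeastAtMost_iff)
    qed
    have "{a..<c} \<subseteq> S"
    proof
      fix s assume "s \<in> {a..<c}"
      then obtain t where "t \<in> P" "s < t"
        unfolding c_def using less_cSupE[of s P] \<open>a \<in> P\<close> by auto
      with \<open>s \<in> {a..<c}\<close> show "s \<in> S"
        by (auto simp: P_def)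
    qed
    moreover have "a \<in> S"
      using \<open>a \<in> P\<close> by (auto simp: P_def)
    ultimately have S_upto: "{a..c} \<subseteq> S"
      using closure_minimal[OF _ \<open>closed S\<close>, of "{a..<c}"] c by (cases "a = c") auto
    have "c = b"
    proof (rule ccontr)
      assume "c \<noteq> b"
      with c have "c < b" by simp
      have "eventually (\<lambda>h. dist ((k (c + h) - k c) /\<^sub>R h) 0 < e) (at_right 0)"
        using tendstoD[OF k_deriv[OF c(1) \<open>c < b\<close>] \<open>e > 0\<close>] .
      then obtain d where d: "d > 0" "\<And>h. 0 < h \<Longrightarrow> h < d \<Longrightarrow> norm ((k (c + h) - k c) /\<^sub>R h) < e"
        by (auto simp: eventually_at_right_field)
      define t where "t = min (c + d / 2) b"
      have "{c<..t} \<subseteq> S"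
      proof
        fix s assume s: "s \<in> {c<..t}"
        define h where "h = s - c"
        have h: "0 < h" "h < d" "s = c + h" "s \<le> b"
          using s \<open>d > 0\<close> by (auto simp: h_def t_def)
        have "norm (k (c + h) - k c) \<le> e * h"
          using d(2)[OF h(1,2)] h(1) unfolding norm_scaleR by (simp add: field_simps)
        moreover have "norm (k c) \<le> e * (c - a)"
          using S_upto c by (auto simp: S_def)
        ultimately have "norm (k s) \<le> e * (s - a)"
          using norm_triangle_sub[of "k (c + h)" "k c"] by (simp add: h(3) algebra_simps)
        then show "s \<in> S"
          using h c by (auto simp: S_def)
      qed
      moreover have "{a..t} \<subseteq> {a..c} \<union> {c<..t}"
        by auto
      moreover have "t \<in> {a..b}"
        using c \<open>c < b\<close> \<open>d > 0\<close> by (auto simp: t_def)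
      ultimately have "t \<in> P"
        using S_upto by (simp add: P_def) blast
      then have "t \<le> c"
        unfolding c_def using bdd by (rule cSup_upper)
      then show False
        using \<open>c < b\<close> \<open>d > 0\<close> by (auto simp: t_def)
    qed
    then have "b \<in> S"
      using S_upto c by auto
    then show ?thesis
      by (simp add: S_def)
  qed
  have "norm (k b) \<le> 0"
  proof (rule field_le_epsilon)
    fix e :: real assume "e > 0"
    have "norm (k b) \<le> e / (b - a + 1) * (b - a)"
      using \<open>e > 0\<close> \<open>a \<le> b\<close> by (intro bound) simp
    also have "\<dots> = e * ((b - a) / (b - a + 1))"
      by simp
    also have "\<dots> \<le> e * 1"
      using \<open>e > 0\<close> \<open>a \<le> b\<close> by (intro mult_left_mono) auto
    finally show "norm (k b) \<le> 0 + e"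
      by simp
  qed
  then show ?thesis
    by (simp add: k_def)
qed

section \<open>Bounded operators on closed subspaces\<close>

lemma tendsto_norm_bound:
  fixes f :: "'a \<Rightarrow> 'b::real_normed_vector"
  assumes "(g \<longlongrightarrow> 0) F" "eventually (\<lambda>x. norm (f x - l) \<le> g x) F"
  shows "(f \<longlongrightarrow> l) F"
  using Lim_null_comparison[OF assms(2,1)] by (simp add: LIM_zero_iff)

lemma integral_tendsto_bounded_continuous:
  fixes f :: "nat \<Rightarrow> real \<Rightarrow> 'a::banach"
  assumes f: "\<And>n. continuous_on {a..b} (f n)" and g: "continuous_on {a..b} g"
    and bound: "\<And>n t. t \<in> {a..b} \<Longrightarrow> norm (f n t) \<le> C"
    and lim: "\<And>t. t \<in> {a..b} \<Longrightarrow> (\<lambda>n. f n t) \<longlonglongrightarrow> g t"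
  shows "(\<lambda>n. integral {a..b} (f n)) \<longlonglongrightarrow> integral {a..b} g"
proof -
  have g_bound: "norm (g t) \<le> C" if "t \<in> {a..b}" for t
    using tendsto_norm[OF lim[OF that]] by (rule LIMSEQ_le_const2) (use bound[OF that] in auto)
  have "(\<lambda>n. integral {a..b} (\<lambda>t. norm (f n t - g t))) \<longlonglongrightarrow> integral {a..b} (\<lambda>t. 0::real)"
  proof (rule dominated_convergence)
    show "(\<lambda>t. norm (f n t - g t)) integrable_on {a..b}" for n
      by (intro integrable_continuous_interval continuous_intros f g)
    show "(\<lambda>_. 2 * C) integrable_on {a..b}"
      by (intro integrable_continuous_interval continuous_intros)
    show "norm (norm (f n t - g t)) \<le> 2 * C" if "t \<in> {a..b}" for n t
      using norm_triangle_ineq4[of "f n t" "g t"] bound[OF that, of n] g_bound[OF that] by simp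
    show "(\<lambda>n. norm (f n t - g t)) \<longlonglongrightarrow> 0" if "t \<in> {a..b}" for t
      using lim[OF that] by (simp add: LIM_zero_iff tendsto_norm_zero_iff)
  qed
  then have lim_norm: "(\<lambda>n. integral {a..b} (\<lambda>t. norm (f n t - g t))) \<longlonglongrightarrow> 0"
    by simp
  have "norm (integral {a..b} (f n) - integral {a..b} g)
      \<le> integral {a..b} (\<lambda>t. norm (f n t - g t))" for n
  proof -
    have "integral {a..b} (f n) - integral {a..b} g = integral {a..b} (\<lambda>t. f n t - g t)"
      by (intro integral_diff[symmetric] integrable_continuous_interval f g)
    also have "norm \<dots> \<le> integral {a..b} (\<lambda>t. norm (f n t - g t))"
      by (intro integral_norm_bound_integral integrable_continuous_interval continuous_intros f g) auto
    finally show ?thesis .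
  qed
  then show ?thesis
    by (intro tendsto_norm_bound[OF lim_norm] always_eventually allI)
qed

lemma bounded_opD:
  assumes "bounded_op S T f"
  shows bounded_op_in: "x \<in> S \<Longrightarrow> f x \<in> T"
    and bounded_op_add: "x \<in> S \<Longrightarrow> y \<in> S \<Longrightarrow> f (x + y) = f x + f y"
    and bounded_op_scaleR: "x \<in> S \<Longrightarrow> f (c *\<^sub>R x) = c *\<^sub>R f x"
  using assms by (auto simp: bounded_op_def linear_op_def)

lemma bounded_op_zero: "bounded_op S T f \<Longrightarrow> 0 \<in> S \<Longrightarrow> f 0 = 0"
  using bounded_op_scaleR[of S T f 0 0] by simp

lemma bounded_op_diff:
  assumes "bounded_op S T f" "subspace S" "x \<in> S" "y \<in> S"
  shows "f (x - y) = f x - f y"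
  using bounded_op_add[OF assms(1,3), of "(-1) *\<^sub>R y"] bounded_op_scaleR[OF assms(1,4), of "-1"]
    subspace_scale[OF assms(2,4), of "-1"] by simp

lemma bounded_op_imp_bounded_linear:
  assumes "bounded_op UNIV UNIV f"
  shows "bounded_linear f"
proof -
  obtain K where "\<And>x. norm (f x) \<le> K * norm x"
    using assms by (auto simp: bounded_op_def)
  then show ?thesis
    using assms by (intro bounded_linear_intro[of f K]) (simp_all add: bounded_opD mult.commute)
qed

lemma bounded_op_op_norm:
  assumes f: "bounded_op S T f" and S: "subspace S" and x: "x \<in> S"
  shows "norm (f x) \<le> op_norm S f * norm x"
proof (cases "x = 0")
  case True
  then show ?thesis
    using bounded_op_zero[OF f] subspace_0[OF S] by simp
next
  case False
  obtain K where K: "\<And>x. x \<in> S \<Longrightarrow> norm (f x) \<le> K * norm x"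
    using f by (auto simp: bounded_op_def)
  have "bdd_above ((\<lambda>x. norm (f x)) ` {x \<in> S. norm x \<le> 1})"
  proof (rule bdd_aboveI2)
    fix x assume "x \<in> {x \<in> S. norm x \<le> 1}"
    then show "norm (f x) \<le> \<bar>K\<bar>"
      using K[of x] mult_mono[of K "\<bar>K\<bar>" "norm x" 1] abs_ge_self[of K] by simp
  qed
  moreover have "x /\<^sub>R norm x \<in> {x \<in> S. norm x \<le> 1}"
    using x S False by (simp add: subspace_scale)
  ultimately have "norm (f (x /\<^sub>R norm x)) \<le> op_norm S f"
    unfolding op_norm_def by (rule cSUP_upper2) simp
  then show ?thesis
    using False bounded_op_scaleR[OF f x] by (simp add: field_simps)
qed

lemma bounded_op_op_norm_bound:
  assumes "bounded_op S T f" "subspace S" "op_norm S f \<le> c" "x \<in> S"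
  shows "norm (f x) \<le> c * norm x"
  using bounded_op_op_norm[OF assms(1,2,4)] mult_right_mono[OF assms(3), of "norm x"] by simp

lemma bounded_op_sub:
  assumes "bounded_op S UNIV f" "bounded_op S UNIV g"
  shows "bounded_op S UNIV (\<lambda>x. f x - g x)"
proof -
  obtain K L where "\<forall>x\<in>S. norm (f x) \<le> K * norm x" "\<forall>x\<in>S. norm (g x) \<le> L * norm x"
    using assms unfolding bounded_op_def by blast
  then have "norm (f x - g x) \<le> (K + L) * norm x" if "x \<in> S" for x
    using norm_triangle_ineq4[of "f x" "g x"] that by (fastforce simp: distrib_right)
  then show ?thesis
    using bounded_opD(2,3)[OF assms(1)] bounded_opD(2,3)[OF assms(2)]
    by (auto simp: bounded_op_def linear_op_def scaleR_diff_right)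
qed

lemma bounded_op_tendsto:
  assumes f: "bounded_op S T f" and S: "subspace S"
    and g: "(g \<longlongrightarrow> l) F" "eventually (\<lambda>x. g x \<in> S) F" "l \<in> S"
  shows "((\<lambda>x. f (g x)) \<longlongrightarrow> f l) F"
proof -
  have "((\<lambda>x. op_norm S f * norm (g x - l)) \<longlongrightarrow> op_norm S f * norm (l - l)) F"
    by (intro tendsto_intros g)
  then have lim: "((\<lambda>x. op_norm S f * norm (g x - l)) \<longlongrightarrow> 0) F"
    by simp
  show ?thesis
  proof (rule tendsto_norm_bound[OF lim])
    show "eventually (\<lambda>x. norm (f (g x) - f l) \<le> op_norm S f * norm (g x - l)) F"
      using g(2)
    proof eventually_elim
      case (elim x)
      then show ?case
        using bounded_op_op_norm[OF f S subspace_diff[OF S elim g(3)]] bounded_op_diff[OF f S elim g(3)]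
        by simp
    qed
  qed
qed

lemma bounded_op_continuous_on:
  assumes "bounded_op S T f" "subspace S" "continuous_on X g" "\<And>x. x \<in> X \<Longrightarrow> g x \<in> S"
  shows "continuous_on X (\<lambda>x. f (g x))"
  using assms(3,4) unfolding continuous_on_def
  by (auto simp: eventually_at_filter intro!: bounded_op_tendsto[OF assms(1,2)])

text \<open>An operator on a closed subspace need not extend to the whole space, so that
  \<open>integral_linear\<close> is not applicable.\<close>

lemma bounded_op_integral:
  fixes g :: "real \<Rightarrow> 'a::banach" and f :: "'a \<Rightarrow> 'b::banach"
  assumes f: "bounded_op S T f" and S: "subspace S" "closed S"
    and g: "continuous_on {a..b} g" "\<And>t. t \<in> {a..b} \<Longrightarrow> g t \<in> S"
  shows "f (integral {a..b} g) = integral {a..b} (\<lambda>t. f (g t))"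
proof (cases "a \<le> b")
  case False
  then show ?thesis
    using bounded_op_zero[OF f] subspace_0[OF S(1)] by simp
next
  case True
  have mem: "integral {a..t} g \<in> S" if "t \<le> b" for t
    using that g
    by (intro integral_in_closed_subspace[OF S] integrable_continuous_interval)
       (auto intro: continuous_on_subset)
  have cont: "continuous_on {a..b} (\<lambda>t. integral {a..t} g)"
    by (intro indefinite_integral_continuous_1 integrable_continuous_interval g)
  have "f (integral {a..b} g) - f (integral {a..a} g) = integral {a..b} (\<lambda>t. f (g t))"
  proof (rule right_derivative_imp_integral[OF True])
    show "continuous_on {a..b} (\<lambda>t. f (integral {a..t} g))"
      using mem by (intro bounded_op_continuous_on[OF f S(1)] cont) auto
    show "continuous_on {a..b} (\<lambda>t. f (g t))"
      by (intro bounded_op_continuous_on[OF f S(1)] g)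
    fix t assume t: "a \<le> t" "t < b"
    have small: "eventually (\<lambda>h. 0 < h \<and> h < b - t) (at_right 0)"
      using t by (auto intro!: eventually_at_right_field[THEN iffD2] exI[of _ "b - t"])
    have "((\<lambda>u. integral {a..u} g) has_vector_derivative g t) (at t within {t..b})"
      using integral_has_vector_derivative[OF g(1), of t] t
      by (auto intro: has_vector_derivative_within_subset)
    then have "((\<lambda>h. (integral {a..t + h} g - integral {a..t} g) /\<^sub>R h) \<longlongrightarrow> g t) (at_right 0)"
      using t(2) by (rule has_vector_derivative_imp_right_quotient)
    then have "((\<lambda>h. f ((integral {a..t + h} g - integral {a..t} g) /\<^sub>R h)) \<longlongrightarrow> f (g t)) (at_right 0)"
    proof (rule bounded_op_tendsto[OF f S(1)])
      show "eventually (\<lambda>h. (integral {a..t + h} g - integral {a..t} g) /\<^sub>R h \<in> S) (at_right 0)"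
        using small by eventually_elim (use t in \<open>auto intro!: subspace_scale subspace_diff S mem\<close>)
    qed (use t g in auto)
    moreover have "eventually (\<lambda>h. f ((integral {a..t + h} g - integral {a..t} g) /\<^sub>R h) =
        (f (integral {a..t + h} g) - f (integral {a..t} g)) /\<^sub>R h) (at_right 0)"
      using small
    proof eventually_elim
      case (elim h)
      have "integral {a..t + h} g \<in> S" "integral {a..t} g \<in> S"
        using elim t by (auto intro!: mem)
      then show ?case
        using f S(1) by (simp add: bounded_op_scaleR bounded_op_diff subspace_diff)
    qed
    ultimately show "((\<lambda>h. (f (integral {a..t + h} g) - f (integral {a..t} g)) /\<^sub>R h) \<longlongrightarrow> f (g t)) (at_right 0)"
      by (rule Lim_transform_eventually)
  qed
  then show ?thesis
    using bounded_op_zero[OF f] subspace_0[OF S(1)] by simp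
qed

section \<open>Improper integrals with exponential decay\<close>

lemma integral_exp_decay_bound:
  fixes f :: "real \<Rightarrow> 'a::banach"
  assumes "a \<le> b" "\<delta> > 0" "C \<ge> 0" and f: "continuous_on {a..b} f"
    and bound: "\<And>s. s \<in> {a..b} \<Longrightarrow> norm (f s) \<le> C * exp (\<delta> * (s - t))"
  shows "norm (integral {a..b} f) \<le> C / \<delta> * exp (\<delta> * (b - t))"
proof -
  have exp_int: "((\<lambda>s. C * exp (\<delta> * (s - t))) has_integral
      C / \<delta> * exp (\<delta> * (b - t)) - C / \<delta> * exp (\<delta> * (a - t))) {a..b}"
    using \<open>\<delta> > 0\<close> \<open>a \<le> b\<close>
    by (intro fundamental_theorem_of_calculus)
       (auto intro!: derivative_eq_intros simp: has_real_derivative_iff_has_vector_derivative[symmetric])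
  have "norm (integral {a..b} f) \<le> integral {a..b} (\<lambda>s. C * exp (\<delta> * (s - t)))"
    using integrable_continuous_interval[OF f] has_integral_integrable[OF exp_int] bound
    by (rule integral_norm_bound_integral)
  also have "\<dots> = C / \<delta> * exp (\<delta> * (b - t)) - C / \<delta> * exp (\<delta> * (a - t))"
    using exp_int by (rule integral_unique)
  also have "\<dots> \<le> C / \<delta> * exp (\<delta> * (b - t))"
    using \<open>\<delta> > 0\<close> \<open>C \<ge> 0\<close> by simp
  finally show ?thesis .
qed

lemma tendsto_exp_at_bot_real:
  assumes "(\<delta>::real) > 0"
  shows "((\<lambda>a. C * exp (\<delta> * (a - t))) \<longlongrightarrow> 0) at_bot"
proof -
  have "filterlim (\<lambda>a. - (\<delta> * (t - a))) at_bot at_bot"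
    using assms
    by (auto intro!: filterlim_tendsto_add_at_top filterlim_tendsto_pos_mult_at_top filterlim_uminus_at_top_at_bot
        simp: filterlim_uminus_at_top[symmetric] diff_conv_add_uminus simp del: add_uminus_conv_diff)
  then have "filterlim (\<lambda>a. \<delta> * (a - t)) at_bot at_bot"
    by (simp add: algebra_simps)
  then have "((\<lambda>a. exp (\<delta> * (a - t))) \<longlongrightarrow> 0) at_bot"
    by (rule filterlim_compose[OF exp_at_bot])
  from tendsto_mult_left[OF this, of C] show ?thesis by simp
qed

lemma integral_atMost_exp_decay:
  fixes f :: "real \<Rightarrow> 'a::banach"
  assumes "\<delta> > 0" and f: "continuous_on {..t} f"
    and bound: "\<And>s. s \<le> t \<Longrightarrow> norm (f s) \<le> C * exp (\<delta> * (s - t))"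
  shows "((\<lambda>a. integral {a..t} f) \<longlongrightarrow> integral {..t} f) at_bot"
proof -
  define I where "I a = integral {a..t} f" for a
  define E where "E c = C / \<delta> * exp (\<delta> * (c - t))" for c
  have "C \<ge> 0"
    using bound[of t] norm_ge_zero[of "f t"] by (simp add: order_trans[of 0 "norm (f t)"])
  have cont: "continuous_on {a..b} f" if "b \<le> t" for a b
    using f that by (auto intro: continuous_on_subset)
  have I_diff: "norm (I a - I c) \<le> E c" if "a \<le> c" "c \<le> t" for a c
  proof -
    have "I a - I c = integral {a..c} f"
      using Henstock_Kurzweil_Integration.integral_combine[OF that integrable_continuous_interval[OF cont]] by (simp add: I_def algebra_simps)
    then show ?thesis
      using integral_exp_decay_bound[OF that(1) \<open>\<delta> > 0\<close> \<open>C \<ge> 0\<close> cont, of t] bound that by (simp add: E_def)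
  qed
  have E0: "(E \<longlongrightarrow> 0) at_bot"
    unfolding E_def using \<open>\<delta> > 0\<close> by (rule tendsto_exp_at_bot_real)
  have E_mono: "E a \<le> E b" if "a \<le> b" for a b
    using that \<open>\<delta> > 0\<close> \<open>C \<ge> 0\<close> by (auto simp: E_def intro!: mult_left_mono divide_right_mono)
  have "Cauchy (\<lambda>n. I (t - real n))"
  proof (rule CauchyI')
    fix e :: real assume "e > 0"
    have "filterlim (\<lambda>n. t - real n) at_bot sequentially"
      unfolding filterlim_at_bot
    proof
      fix Z
      show "eventually (\<lambda>n. t - real n \<le> Z) sequentially"
        by (rule eventually_sequentiallyI[of "nat \<lceil>t - Z\<rceil>"]) linarith
    qed
    from order_tendstoD(2)[OF filterlim_compose[OF E0 this] \<open>e > 0\<close>]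
    obtain N where N: "\<And>n. n \<ge> N \<Longrightarrow> E (t - real n) < e"
      by (auto simp: eventually_sequentially)
    show "\<exists>M. \<forall>m\<ge>M. \<forall>n>m. dist (I (t - real m)) (I (t - real n)) < e"
    proof (intro exI[of _ N] allI impI)
      fix m n :: nat assume "N \<le> m" "m < n"
      then show "dist (I (t - real m)) (I (t - real n)) < e"
        using I_diff[of "t - real n" "t - real m"] N[of m] by (simp add: dist_norm norm_minus_commute)
    qed
  qed
  then obtain L where L: "(\<lambda>n. I (t - real n)) \<longlonglongrightarrow> L"
    using Cauchy_convergent by (auto simp: convergent_def)
  have I_L: "norm (I c - L) \<le> E c" if "c \<le> t" for c
  proof (rule LIMSEQ_le_const2)
    show "(\<lambda>n. norm (I c - I (t - real n))) \<longlonglongrightarrow> norm (I c - L)"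
      by (intro tendsto_intros L)
    obtain N where N: "real N \<ge> t - c"
      using real_arch_simple by blast
    have "norm (I c - I (t - real n)) \<le> E c" if "n \<ge> N" for n
      using I_diff[of "t - real n" c] N that \<open>c \<le> t\<close> by (simp add: norm_minus_commute)
    then show "\<exists>N. \<forall>n\<ge>N. norm (I c - I (t - real n)) \<le> E c"
      by blast
  qed
  have "(f has_integral L) {..t}"
    unfolding has_integral_alt'
  proof (intro conjI allI impI)
    show "(\<lambda>x. if x \<in> {..t} then f x else 0) integrable_on cbox a b" for a b
    proof -
      have "{a..b} \<inter> {..t} = {a..min b t}" by auto
      then show ?thesis
        unfolding cbox_interval integrable_restrict_Int
        using integrable_continuous_interval[OF cont, of "min b t" a] by (simp add: Int_commute min.commute)
    qed
    fix e :: real assume "e > 0"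
    from order_tendstoD(2)[OF E0 this] obtain B where B: "\<And>c. c \<le> B \<Longrightarrow> E c < e"
      by (auto simp: eventually_at_bot_linorder)
    show "\<exists>B>0. \<forall>a b. ball 0 B \<subseteq> cbox a b \<longrightarrow>
        norm (integral (cbox a b) (\<lambda>x. if x \<in> {..t} then f x else 0) - L) < e"
    proof (intro exI[of _ "\<bar>t\<bar> + \<bar>B\<bar> + 1"] conjI allI impI)
      fix a b assume "ball (0::real) (\<bar>t\<bar> + \<bar>B\<bar> + 1) \<subseteq> cbox a b"
      moreover have "- \<bar>t\<bar> - \<bar>B\<bar> \<in> ball (0::real) (\<bar>t\<bar> + \<bar>B\<bar> + 1)" "t \<in> ball (0::real) (\<bar>t\<bar> + \<bar>B\<bar> + 1)"
        by (auto simp: dist_real_def)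
      ultimately have "- \<bar>t\<bar> - \<bar>B\<bar> \<in> cbox a b" "t \<in> cbox a b"
        by blast+
      then have ab: "a \<le> - \<bar>t\<bar> - \<bar>B\<bar>" "t \<le> b"
        by simp_all
      then have "{..t} \<inter> {a..b} = {a..t}"
        by auto
      then have "integral (cbox a b) (\<lambda>x. if x \<in> {..t} then f x else 0) = I a"
        unfolding cbox_interval integral_restrict_Int by (simp only: I_def)
      moreover have "a \<le> t" "a \<le> B"
        using ab by linarith+
      ultimately show "norm (integral (cbox a b) (\<lambda>x. if x \<in> {..t} then f x else 0) - L) < e"
        using I_L[of a] B[of a] by simp
    qed auto
  qed
  then have "integral {..t} f = L"
    by (rule integral_unique)
  moreover have "(I \<longlongrightarrow> L) at_bot"
  proof (rule tendsto_norm_bound[OF E0])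
    show "eventually (\<lambda>c. norm (I c - L) \<le> E c) at_bot"
      using eventually_le_at_bot[of t] by eventually_elim (rule I_L)
  qed
  ultimately show ?thesis
    unfolding I_def by simp
qed

section \<open>Almost periodic operator families and functions\<close>

lemma op_norm_least:
  assumes "0 \<in> S" "\<And>x. x \<in> S \<Longrightarrow> norm x \<le> 1 \<Longrightarrow> norm (f x) \<le> c"
  shows "op_norm S f \<le> c"
  unfolding op_norm_def by (rule cSUP_least) (use assms in auto)

lemma op_norm_nonneg:
  assumes f: "bounded_op S T f" and S: "subspace S"
  shows "0 \<le> op_norm S f"
proof (cases "\<exists>x\<in>S. x \<noteq> 0")
  case True
  then obtain x where "x \<in> S" "norm x > 0"
    by auto
  then show ?thesis
    using bounded_op_op_norm[OF f S] by (smt (verit) norm_ge_zero zero_le_mult_iff)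
next
  case False
  then have "{x \<in> S. norm x \<le> 1} = {0}"
    using subspace_0[OF S] by auto
  then show ?thesis
    by (simp add: op_norm_def)
qed

lemma op_dist_commute: "op_dist S f g = op_dist S g f"
  by (simp add: op_dist_def op_norm_def norm_minus_commute)

lemma op_dist_bound:
  assumes "bounded_op S UNIV f" "bounded_op S UNIV g" "subspace S" "x \<in> S"
  shows "norm (f x - g x) \<le> op_dist S f g * norm x"
  using bounded_op_op_norm[OF bounded_op_sub[OF assms(1,2)] assms(3,4)] by (simp add: op_dist_def)

lemma op_norm_le_add_op_dist:
  assumes f: "bounded_op S UNIV f" and g: "bounded_op S UNIV g" and S: "subspace S"
  shows "op_norm S f \<le> op_norm S g + op_dist S f g"
proof (rule op_norm_least[OF subspace_0[OF S]])
  fix x assume x: "x \<in> S" "norm x \<le> 1"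
  have nonneg: "0 \<le> op_norm S g" "0 \<le> op_dist S f g"
    unfolding op_dist_def by (intro op_norm_nonneg[OF g S] op_norm_nonneg[OF bounded_op_sub[OF f g] S])+
  have "norm (f x) \<le> norm (g x) + norm (f x - g x)"
    by (rule norm_triangle_sub)
  also have "\<dots> \<le> op_norm S g * norm x + op_dist S f g * norm x"
    by (intro add_mono bounded_op_op_norm[OF g S x(1)] op_dist_bound[OF f g S x(1)])
  also have "\<dots> \<le> op_norm S g + op_dist S f g"
    using x(2) nonneg by (intro add_mono mult_left_le)
  finally show "norm (f x) \<le> op_norm S g + op_dist S f g" .
qed

lemma almost_periodic_op_continuous_on:
  assumes G: "almost_periodic {f. bounded_op S UNIV f} (op_dist S) G" and S: "subspace S"
    and u: "continuous_on I u" "\<And>t. t \<in> I \<Longrightarrow> u t \<in> S"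
  shows "continuous_on I (\<lambda>t. G t (u t))"
  unfolding continuous_on_def
proof
  have bop: "bounded_op S UNIV (G t)" for t
    using G by (simp add: almost_periodic_def)
  fix t assume t: "t \<in> I"
  have u_lim: "(u \<longlongrightarrow> u t) (at t within I)"
    using u(1) t by (simp add: continuous_on_def)
  have mem: "eventually (\<lambda>s. u s \<in> S) (at t within I)"
    using u(2) by (simp add: eventually_at_filter)
  have "((\<lambda>s. op_dist S (G s) (G t)) \<longlongrightarrow> 0) (at t)"
    using G by (simp add: almost_periodic_def)
  then have dist_lim: "((\<lambda>s. op_dist S (G s) (G t)) \<longlongrightarrow> 0) (at t within I)"
    by (rule tendsto_within_subset) simp
  have Gt_lim: "((\<lambda>s. G t (u s)) \<longlongrightarrow> G t (u t)) (at t within I)"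
    using u_lim mem u(2)[OF t] by (rule bounded_op_tendsto[OF bop S])
  have "((\<lambda>s. op_dist S (G s) (G t) * norm (u s) + norm (G t (u s) - G t (u t))) \<longlongrightarrow>
      0 * norm (u t) + norm (G t (u t) - G t (u t))) (at t within I)"
    by (intro tendsto_intros dist_lim u_lim Gt_lim)
  then have bound_lim: "((\<lambda>s. op_dist S (G s) (G t) * norm (u s) + norm (G t (u s) - G t (u t))) \<longlongrightarrow> 0)
      (at t within I)"
    by simp
  show "((\<lambda>s. G s (u s)) \<longlongrightarrow> G t (u t)) (at t within I)"
  proof (rule tendsto_norm_bound[OF bound_lim])
    show "eventually (\<lambda>s. norm (G s (u s) - G t (u t))
        \<le> op_dist S (G s) (G t) * norm (u s) + norm (G t (u s) - G t (u t))) (at t within I)"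
      using mem
    proof eventually_elim
      case (elim s)
      then show ?case
        using op_dist_bound[OF bop bop S elim, of s t]
          norm_triangle_ineq[of "G s (u s) - G t (u s)" "G t (u s) - G t (u t)"] by simp
    qed
  qed
qed

lemma almost_periodic_op_bounded:
  assumes G: "almost_periodic {f. bounded_op S UNIV f} (op_dist S) G" and S: "subspace S"
  obtains C where "\<And>t x. x \<in> S \<Longrightarrow> norm (G t x) \<le> C * norm x"
proof -
  have bop: "bounded_op S UNIV (G t)" for t
    using G by (simp add: almost_periodic_def)
  have "relatively_dense (translation_set (op_dist S) G 1)"
    using G by (simp add: almost_periodic_def)
  then obtain l where l: "l > 0" "\<And>c. {c..c + l} \<inter> translation_set (op_dist S) G 1 \<noteq> {}"
    unfolding relatively_dense_def by blast
  have "continuous_on {0..l} (\<lambda>t. op_norm S (G t))"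
    unfolding continuous_on_def
  proof
    fix t assume "t \<in> {0..l}"
    have "((\<lambda>s. op_dist S (G s) (G t)) \<longlongrightarrow> 0) (at t)"
      using G by (simp add: almost_periodic_def)
    then have "((\<lambda>s. op_dist S (G s) (G t)) \<longlongrightarrow> 0) (at t within {0..l})"
      by (rule tendsto_within_subset) simp
    then show "((\<lambda>s. op_norm S (G s)) \<longlongrightarrow> op_norm S (G t)) (at t within {0..l})"
    proof (rule tendsto_norm_bound, intro always_eventually allI)
      fix s
      show "norm (op_norm S (G s) - op_norm S (G t)) \<le> op_dist S (G s) (G t)"
        using op_norm_le_add_op_dist[OF bop bop S, of s t] op_norm_le_add_op_dist[OF bop bop S, of t s]
        by (simp add: abs_le_iff op_dist_commute)
    qed
  qed
  then have "bounded ((\<lambda>t. op_norm S (G t)) ` {0..l})"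
    by (intro compact_imp_bounded compact_continuous_image) auto
  then obtain C where C: "\<And>t. t \<in> {0..l} \<Longrightarrow> op_norm S (G t) \<le> C"
    unfolding bounded_iff by (metis abs_le_D1 imageI real_norm_def)
  have "norm (G t x) \<le> (C + 1) * norm x" if "x \<in> S" for t x
  proof -
    obtain \<tau> where \<tau>: "\<tau> \<in> {- t..- t + l}" "\<tau> \<in> translation_set (op_dist S) G 1"
      using l(2)[of "- t"] by blast
    have "op_dist S (G t) (G (t + \<tau>)) < 1"
      using \<tau>(2) by (simp add: translation_set_def op_dist_commute)
    moreover have "op_norm S (G (t + \<tau>)) \<le> C"
      using \<tau>(1) by (intro C) auto
    ultimately have "op_norm S (G t) \<le> C + 1"
      using op_norm_le_add_op_dist[OF bop bop S, of t "t + \<tau>"] by linarith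
    with that show ?thesis
      by (intro bounded_op_op_norm_bound[OF bop S])
  qed
  then show ?thesis
    by (rule that)
qed

lemma AP_in: "\<phi> \<in> AP S \<Longrightarrow> apply_bcontfun \<phi> t \<in> S"
  by (simp add: AP_def almost_periodic_def)

lemma apply_mult_op:
  assumes G: "almost_periodic {f. bounded_op S UNIV f} (op_dist S) G" and S: "subspace S"
    and \<phi>: "\<phi> \<in> AP S"
  shows "apply_bcontfun (mult_op G \<phi>) t = G t (apply_bcontfun \<phi> t)"
proof -
  obtain C where C: "\<And>t x. x \<in> S \<Longrightarrow> norm (G t x) \<le> C * norm x"
    by (rule almost_periodic_op_bounded[OF G S]) blast
  have "(\<lambda>t. G t (apply_bcontfun \<phi> t)) \<in> bcontfun"
  proof (rule bcontfun_normI)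
    show "continuous_on UNIV (\<lambda>t. G t (apply_bcontfun \<phi> t))"
      by (rule almost_periodic_op_continuous_on[OF G S]) (auto intro: AP_in \<phi>)
    fix t
    have "norm (G t (apply_bcontfun \<phi> t)) \<le> C * norm (apply_bcontfun \<phi> t)"
      by (intro C AP_in \<phi>)
    also have "\<dots> \<le> \<bar>C\<bar> * norm \<phi>"
      by (intro mult_mono norm_bounded) auto
    finally show "norm (G t (apply_bcontfun \<phi> t)) \<le> \<bar>C\<bar> * norm \<phi>" .
  qed
  then show ?thesis
    by (simp add: mult_op_def Bcontfun_inverse)
qed

lemma tendsto_apply_bcontfun:
  fixes l :: "'a::t2_space \<Rightarrow>\<^sub>C 'b::metric_space"
  assumes f: "(f \<longlongrightarrow> l) F" and p: "(p \<longlongrightarrow> q) F"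
  shows "((\<lambda>x. apply_bcontfun (f x) (p x)) \<longlongrightarrow> apply_bcontfun l q) F"
proof (rule tendsto_dist_iff[THEN iffD2])
  have "isCont (apply_bcontfun l) q"
    using continuous_on_eq_continuous_at[OF open_UNIV, of "apply_bcontfun l"] continuous_on_apply_bcontfun[of UNIV l] by blast
  then have "((\<lambda>x. apply_bcontfun l (p x)) \<longlongrightarrow> apply_bcontfun l q) F"
    using p by (rule isCont_tendsto_compose)
  from tendsto_add[OF tendsto_dist_iff[THEN iffD1, OF f] tendsto_dist_iff[THEN iffD1, OF this]]
  have lim: "((\<lambda>x. dist (f x) l + dist (apply_bcontfun l (p x)) (apply_bcontfun l q)) \<longlongrightarrow> 0) F"
    by simp
  have "norm (dist (apply_bcontfun (f x) (p x)) (apply_bcontfun l q))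
      \<le> dist (f x) l + dist (apply_bcontfun l (p x)) (apply_bcontfun l q)" for x
    using dist_triangle[of "apply_bcontfun (f x) (p x)" "apply_bcontfun l q" "apply_bcontfun l (p x)"]
      dist_bounded[of "f x" "p x" l] by simp
  then show "((\<lambda>x. dist (apply_bcontfun (f x) (p x)) (apply_bcontfun l q)) \<longlongrightarrow> 0) F"
    by (intro Lim_null_comparison[OF _ lim] always_eventually allI)
qed

lemma closed_AP:
  fixes S :: "'a::metric_space set"
  assumes "closed S"
  shows "closed (AP S)"
  unfolding closed_sequential_limits
proof (intro allI impI, elim conjE)
  fix f :: "nat \<Rightarrow> real \<Rightarrow>\<^sub>C 'a" and l
  assume f: "\<forall>n. f n \<in> AP S" and lim: "f \<longlonglongrightarrow> l"
  have "almost_periodic S dist (apply_bcontfun l)"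
    unfolding almost_periodic_dist_iff
  proof (intro conjI allI impI)
    have "apply_bcontfun l t \<in> S" for t
    proof (rule closed_sequentially[OF assms])
      show "(\<lambda>n. apply_bcontfun (f n) t) \<longlonglongrightarrow> apply_bcontfun l t"
        using lim tendsto_const by (rule tendsto_apply_bcontfun)
      show "apply_bcontfun (f n) t \<in> S" for n
        using f AP_in by blast
    qed
    then show "range (apply_bcontfun l) \<subseteq> S"
      by blast
    show "continuous_on UNIV (apply_bcontfun l)"
      by simp
    fix \<epsilon> :: real assume "\<epsilon> > 0"
    then obtain n where n: "dist (f n) l < \<epsilon> / 3"
      using metric_LIMSEQ_D[OF lim, of "\<epsilon> / 3"] by auto
    have "translation_set dist (apply_bcontfun (f n)) (\<epsilon> / 3) \<subseteq> translation_set dist (apply_bcontfun l) \<epsilon>"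
    proof
      fix \<tau> assume \<tau>: "\<tau> \<in> translation_set dist (apply_bcontfun (f n)) (\<epsilon> / 3)"
      have "dist (apply_bcontfun l (t + \<tau>)) (apply_bcontfun l t) < \<epsilon>" for t
      proof -
        have "dist (apply_bcontfun (f n) (t + \<tau>)) (apply_bcontfun (f n) t) < \<epsilon> / 3"
          using \<tau> by (simp add: translation_set_def)
        then show ?thesis
          using n dist_bounded[of "f n" t l] dist_bounded[of "f n" "t + \<tau>" l]
            dist_triangle[of "apply_bcontfun l (t + \<tau>)" "apply_bcontfun l t" "apply_bcontfun (f n) (t + \<tau>)"]
            dist_triangle[of "apply_bcontfun (f n) (t + \<tau>)" "apply_bcontfun l t" "apply_bcontfun (f n) t"]
          by (simp add: dist_commute)
      qed
      then show "\<tau> \<in> translation_set dist (apply_bcontfun l) \<epsilon>"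
        by (simp add: translation_set_def)
    qed
    moreover have "relatively_dense (translation_set dist (apply_bcontfun (f n)) (\<epsilon> / 3))"
      using f \<open>\<epsilon> > 0\<close> by (simp add: AP_def almost_periodic_def)
    ultimately show "relatively_dense (translation_set dist (apply_bcontfun l) \<epsilon>)"
      unfolding relatively_dense_def by fast
  qed
  then show "l \<in> AP S"
    by (simp add: AP_def)
qed

lemma AP_eq: "AP S = {\<phi> \<in> AP UNIV. \<forall>t. apply_bcontfun \<phi> t \<in> S}"
  by (auto simp: AP_def almost_periodic_def)

lemma subspace_AP:
  assumes "subspace (AP (UNIV :: 'a::real_normed_vector set))" "subspace (S :: 'a set)"
  shows "subspace (AP S)"
  using assms unfolding AP_eq[of S] by (auto simp: subspace_def)

section \<open>Resolvents, mild solutions and evolution families\<close>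

lemma resolvent_setD:
  assumes "\<kappa> \<in> resolvent_set E D A"
  shows resolvent_in: "x \<in> E \<Longrightarrow> resolvent D A \<kappa> x \<in> D"
    and resolvent_right_inverse: "x \<in> E \<Longrightarrow> \<kappa> *\<^sub>R resolvent D A \<kappa> x - A (resolvent D A \<kappa> x) = x"
    and resolvent_left_inverse: "x \<in> D \<Longrightarrow> resolvent D A \<kappa> (\<kappa> *\<^sub>R x - A x) = x"
proof -
  have bij: "bij_betw (\<lambda>x. \<kappa> *\<^sub>R x - A x) D E"
    using assms by (simp add: resolvent_set_def)
  show "resolvent D A \<kappa> x \<in> D" if "x \<in> E"
    using that bij unfolding resolvent_def by (metis bij_betw_imp_surj_on inv_into_into)
  show "\<kappa> *\<^sub>R resolvent D A \<kappa> x - A (resolvent D A \<kappa> x) = x" if "x \<in> E"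
    using bij_betw_inv_into_right[OF bij that] by (simp add: resolvent_def)
  show "resolvent D A \<kappa> (\<kappa> *\<^sub>R x - A x) = x" if "x \<in> D"
    using bij_betw_inv_into_left[OF bij that] by (simp add: resolvent_def)
qed

lemma resolvent_eq_iff:
  assumes "\<kappa> \<in> resolvent_set E D A" "y \<in> E"
  shows "x \<in> D \<and> \<kappa> *\<^sub>R x - A x = y \<longleftrightarrow> x = resolvent D A \<kappa> y"
  using resolvent_setD[OF assms(1)] assms(2) by auto

lemma bounded_linear_resolvent:
  "\<kappa> \<in> resolvent_set UNIV D A \<Longrightarrow> bounded_linear (resolvent D A \<kappa>)"
  by (intro bounded_op_imp_bounded_linear) (simp add: resolvent_set_def)

lemma resolvent_identity:
  assumes "\<kappa> \<in> resolvent_set UNIV D A" "\<mu> \<in> resolvent_set UNIV D A"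
  shows "(\<kappa> - \<mu>) *\<^sub>R resolvent D A \<kappa> (resolvent D A \<mu> x) = resolvent D A \<mu> x - resolvent D A \<kappa> x"
proof -
  interpret R: bounded_linear "resolvent D A \<kappa>"
    by (rule bounded_linear_resolvent[OF assms(1)])
  let ?y = "resolvent D A \<mu> x"
  have "\<kappa> *\<^sub>R ?y - A ?y = (\<kappa> - \<mu>) *\<^sub>R ?y + x"
    using resolvent_right_inverse[OF assms(2), of x] by (simp add: algebra_simps)
  then have "resolvent D A \<kappa> ((\<kappa> - \<mu>) *\<^sub>R ?y + x) = ?y"
    using resolvent_left_inverse[OF assms(1) resolvent_in[OF assms(2)], of x] by simp
  then show ?thesis
    unfolding R.add R.scaleR by (simp add: eq_diff_eq)
qed

lemma hille_yosida_norm_resolvent: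
  assumes "hille_yosida UNIV D A M \<omega>" "\<mu> > \<omega>"
  shows "norm (resolvent D A \<mu> x) \<le> M / (\<mu> - \<omega>) * norm x"
proof -
  have "op_norm UNIV (resolvent D A \<mu> ^^ 1) \<le> M / (\<mu> - \<omega>) ^ 1"
    using assms unfolding hille_yosida_def by blast
  then have "op_norm UNIV (resolvent D A \<mu>) \<le> M / (\<mu> - \<omega>)"
    by simp
  moreover have "bounded_op UNIV UNIV (resolvent D A \<mu>)"
    using assms by (simp add: hille_yosida_def resolvent_set_def)
  ultimately show ?thesis
    by (intro bounded_op_op_norm_bound[where S = UNIV and T = UNIV]) simp_all
qed

lemma hille_yosida_scaled_resolvent_bound:
  assumes A: "hille_yosida UNIV D A M \<omega>"
  shows "eventually (\<lambda>\<mu>. \<forall>x. norm (\<mu> *\<^sub>R resolvent D A \<mu> x) \<le> 2 * M * norm x) at_top"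
  using eventually_ge_at_top[of "2 * \<bar>\<omega>\<bar> + 1"]
proof eventually_elim
  case (elim \<mu>)
  have M: "M \<ge> 1"
    using A by (simp add: hille_yosida_def)
  have "norm (\<mu> *\<^sub>R resolvent D A \<mu> x) \<le> 2 * M * norm x" for x
  proof -
    have "norm (\<mu> *\<^sub>R resolvent D A \<mu> x) \<le> \<mu> * (M / (\<mu> - \<omega>) * norm x)"
      using mult_left_mono[OF hille_yosida_norm_resolvent[OF A, of \<mu> x], of \<mu>] elim by simp
    also have "\<dots> = \<mu> / (\<mu> - \<omega>) * (M * norm x)"
      by simp
    also have "\<dots> \<le> 2 * (M * norm x)"
      using elim M by (intro mult_right_mono) (auto simp: field_simps)
    finally show ?thesis
      by simp
  qed
  then show ?case ..
qed

lemma hille_yosida_resolvent_scaled_tendsto: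
  assumes A: "hille_yosida UNIV D A M \<omega>" and \<kappa>: "\<kappa> \<in> resolvent_set UNIV D A"
  shows "((\<lambda>\<mu>. resolvent D A \<kappa> (\<mu> *\<^sub>R resolvent D A \<mu> x)) \<longlongrightarrow> resolvent D A \<kappa> x) at_top"
proof -
  interpret R: bounded_linear "resolvent D A \<kappa>"
    by (rule bounded_linear_resolvent[OF \<kappa>])
  have large: "eventually (\<lambda>\<mu>. \<mu> > \<bar>\<omega>\<bar> \<and> \<mu> > \<bar>\<kappa>\<bar>) at_top"
    by (intro eventually_conj eventually_gt_at_top)
  have res: "((\<lambda>\<mu>. resolvent D A \<mu> x) \<longlongrightarrow> 0) at_top"
  proof (rule tendsto_norm_bound)
    have "filterlim (\<lambda>\<mu>. \<mu> - \<omega>) at_top at_top"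
      unfolding filterlim_at_top
    proof
      fix Z
      show "eventually (\<lambda>\<mu>. Z \<le> \<mu> - \<omega>) at_top"
        using eventually_ge_at_top[of "Z + \<omega>"] by eventually_elim simp
    qed
    then have "((\<lambda>\<mu>. M / (\<mu> - \<omega>)) \<longlongrightarrow> 0) at_top"
      by (intro tendsto_divide_0[of _ M] filterlim_at_top_imp_at_infinity) auto
    from tendsto_mult_right[OF this, of "norm x"]
    show "((\<lambda>\<mu>. M / (\<mu> - \<omega>) * norm x) \<longlongrightarrow> 0) at_top"
      by simp
    show "eventually (\<lambda>\<mu>. norm (resolvent D A \<mu> x - 0) \<le> M / (\<mu> - \<omega>) * norm x) at_top"
      using large by eventually_elim (use hille_yosida_norm_resolvent[OF A, of _ x] in auto)
  qed
  have "((\<lambda>\<mu>. \<kappa> / \<mu>) \<longlongrightarrow> 0) at_top"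
    by (intro tendsto_divide_0[of _ \<kappa>] filterlim_at_top_imp_at_infinity filterlim_ident) auto
  then have "((\<lambda>\<mu>. inverse (\<kappa> / \<mu> - 1)) \<longlongrightarrow> inverse (0 - 1)) at_top"
    by (intro tendsto_intros) auto
  moreover have "eventually (\<lambda>\<mu>. inverse (\<kappa> / \<mu> - 1) = \<mu> / (\<kappa> - \<mu>)) at_top"
    using large by eventually_elim (auto simp: field_simps)
  ultimately have quot: "((\<lambda>\<mu>. \<mu> / (\<kappa> - \<mu>)) \<longlongrightarrow> - 1) at_top"
    using Lim_transform_eventually by fastforce
  have "((\<lambda>\<mu>. (\<mu> / (\<kappa> - \<mu>)) *\<^sub>R (resolvent D A \<mu> x - resolvent D A \<kappa> x)) \<longlongrightarrow>
      (- 1) *\<^sub>R (0 - resolvent D A \<kappa> x)) at_top"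
    by (intro tendsto_intros quot res)
  moreover have "eventually (\<lambda>\<mu>. (\<mu> / (\<kappa> - \<mu>)) *\<^sub>R (resolvent D A \<mu> x - resolvent D A \<kappa> x) =
      resolvent D A \<kappa> (\<mu> *\<^sub>R resolvent D A \<mu> x)) at_top"
    using large
  proof eventually_elim
    case (elim \<mu>)
    then have "\<mu> \<in> resolvent_set UNIV D A" "\<kappa> \<noteq> \<mu>"
      using A by (auto simp: hille_yosida_def)
    then show ?case
      using resolvent_identity[OF \<kappa>, of \<mu> x, symmetric] by (simp add: R.scaleR)
  qed
  ultimately show ?thesis
    using Lim_transform_eventually by fastforce
qed

text \<open>Applying the resolvent \<open>R\<close> turns the mild formulation, in which the unbounded operator
  occurs, into an integral equation between bounded operators, because \<open>R A = \<kappa> R - I\<close>.\<close>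

lemma mild_solution_iff:
  fixes A :: "'a::banach \<Rightarrow> 'a"
  assumes \<kappa>: "\<kappa> \<in> resolvent_set UNIV D A"
    and u: "continuous_on {t0..} u" "\<And>t. t \<ge> t0 \<Longrightarrow> u t \<in> closure D"
    and G: "continuous_on {t0..} (\<lambda>t. G t (u t))"
  shows "mild_solution D A G t0 u0 u \<longleftrightarrow> (\<forall>t\<ge>t0. resolvent D A \<kappa> (u t) - resolvent D A \<kappa> u0 =
    integral {t0..t} (\<lambda>s. \<kappa> *\<^sub>R resolvent D A \<kappa> (u s) - u s + resolvent D A \<kappa> (G s (u s))))"
proof -
  let ?R = "resolvent D A \<kappa>"
  interpret R: bounded_linear ?R
    by (rule bounded_linear_resolvent[OF \<kappa>])
  have "(integral {t0..t} u \<in> D \<and> u t = u0 + A (integral {t0..t} u) + integral {t0..t} (\<lambda>s. G s (u s))) \<longleftrightarrow>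
    ?R (u t) - ?R u0 = integral {t0..t} (\<lambda>s. \<kappa> *\<^sub>R ?R (u s) - u s + ?R (G s (u s)))"
    (is "?L \<longleftrightarrow> ?Q") if "t \<ge> t0" for t
  proof -
    define J where "J = integral {t0..t} u"
    define K where "K = integral {t0..t} (\<lambda>s. G s (u s))"
    have cont: "continuous_on {t0..t} u" "continuous_on {t0..t} (\<lambda>t. G t (u t))"
      using u(1) G by (auto intro: continuous_on_subset)
    note int = integrable_continuous_interval[OF cont(1)] integrable_continuous_interval[OF cont(2)]
    have intR: "(\<lambda>s. ?R (u s)) integrable_on {t0..t}" "(\<lambda>s. ?R (G s (u s))) integrable_on {t0..t}"
      by (intro integrable_continuous_interval R.continuous_on cont)+
    have R_int: "integral {t0..t} (\<lambda>s. ?R (u s)) = ?R J" "integral {t0..t} (\<lambda>s. ?R (G s (u s))) = ?R K"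
      unfolding J_def K_def using integral_linear[OF int(1) R.bounded_linear_axioms]
        integral_linear[OF int(2) R.bounded_linear_axioms] by (simp_all add: o_def)
    have rhs: "integral {t0..t} (\<lambda>s. \<kappa> *\<^sub>R ?R (u s) - u s + ?R (G s (u s))) = \<kappa> *\<^sub>R ?R J - J + ?R K"
      using int intR
      by (simp add: integral_add integral_diff integrable_add integrable_diff integrable_cmul R_int
          flip: J_def)
    have "?L \<longleftrightarrow> J \<in> D \<and> \<kappa> *\<^sub>R J - A J = \<kappa> *\<^sub>R J - u t + u0 + K"
      unfolding J_def[symmetric] K_def[symmetric] by (auto simp: algebra_simps)
    also have "\<dots> \<longleftrightarrow> J = ?R (\<kappa> *\<^sub>R J - u t + u0 + K)"
      by (rule resolvent_eq_iff[OF \<kappa> UNIV_I])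
    also have "\<dots> \<longleftrightarrow> ?Q"
      unfolding rhs R.add R.diff R.scaleR by (auto simp: algebra_simps)
    finally show ?thesis .
  qed
  then show ?thesis
    using u unfolding mild_solution_def by blast
qed

lemma evolution_family_bound:
  assumes U: "evolution_family E U" "exponentially_bounded E U \<omega>" and E: "subspace E"
  obtains M where "M \<ge> 1" "\<And>s t x. s \<le> t \<Longrightarrow> x \<in> E \<Longrightarrow> norm (U t s x) \<le> M * exp (\<omega> * (t - s)) * norm x"
proof -
  obtain M where M: "M \<ge> 1" "\<And>s t. s \<le> t \<Longrightarrow> op_norm E (U t s) \<le> M * exp (\<omega> * (t - s))"
    using U(2) by (auto simp: exponentially_bounded_def)
  have "norm (U t s x) \<le> M * exp (\<omega> * (t - s)) * norm x" if "s \<le> t" "x \<in> E" for s t x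
    using U(1) that by (intro bounded_op_op_norm_bound[OF _ E M(2)]) (auto simp: evolution_family_def)
  with M(1) show ?thesis
    by (rule that)
qed

lemma evolution_family_continuous_on:
  fixes u :: "'b::topological_space \<Rightarrow> 'a::real_normed_vector"
  assumes U: "evolution_family E U" "exponentially_bounded E U \<omega>" and E: "subspace E"
    and pq: "continuous_on I p" "continuous_on I q" "\<And>z. z \<in> I \<Longrightarrow> q z \<le> p z"
    and u: "continuous_on I u" "\<And>z. z \<in> I \<Longrightarrow> u z \<in> E"
  shows "continuous_on I (\<lambda>z. U (p z) (q z) (u z))"
  unfolding continuous_on_def
proof
  obtain M where M: "\<And>s t x. s \<le> t \<Longrightarrow> x \<in> E \<Longrightarrow> norm (U t s x) \<le> M * exp (\<omega> * (t - s)) * norm x"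
    using evolution_family_bound[OF U E] by metis
  have bop: "bounded_op E E (U t s)" if "s \<le> t" for t s
    using U(1) that by (simp add: evolution_family_def)
  fix z assume z: "z \<in> I"
  have lim: "(p \<longlongrightarrow> p z) (at z within I)" "(q \<longlongrightarrow> q z) (at z within I)" "(u \<longlongrightarrow> u z) (at z within I)"
    using pq u z by (auto simp: continuous_on_def)
  have "continuous_on {(t, s). s \<le> t} (\<lambda>(t, s). U t s (u z))"
    using U(1) u(2)[OF z] by (simp add: evolution_family_def)
  then have "continuous_on I (\<lambda>y. (\<lambda>(t, s). U t s (u z)) (p y, q y))"
    by (rule continuous_on_compose2) (use pq in \<open>auto intro!: continuous_on_Pair\<close>)
  then have strong: "((\<lambda>y. U (p y) (q y) (u z)) \<longlongrightarrow> U (p z) (q z) (u z)) (at z within I)"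
    using z by (simp add: continuous_on_def)
  have "((\<lambda>y. M * exp (\<omega> * (p y - q y)) * norm (u y - u z) + norm (U (p y) (q y) (u z) - U (p z) (q z) (u z))) \<longlongrightarrow>
      M * exp (\<omega> * (p z - q z)) * norm (u z - u z) + norm (U (p z) (q z) (u z) - U (p z) (q z) (u z))) (at z within I)"
    by (intro tendsto_intros lim strong)
  then have bound_lim: "((\<lambda>y. M * exp (\<omega> * (p y - q y)) * norm (u y - u z) +
      norm (U (p y) (q y) (u z) - U (p z) (q z) (u z))) \<longlongrightarrow> 0) (at z within I)"
    by simp
  have mem: "eventually (\<lambda>y. y \<in> I) (at z within I)"
    by (simp add: eventually_at_filter)
  show "((\<lambda>y. U (p y) (q y) (u y)) \<longlongrightarrow> U (p z) (q z) (u z)) (at z within I)"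
  proof (rule tendsto_norm_bound[OF bound_lim eventually_mono[OF mem]])
    fix y assume elim: "y \<in> I"
    have "U (p y) (q y) (u y - u z) = U (p y) (q y) (u y) - U (p y) (q y) (u z)"
      by (rule bounded_op_diff[OF bop E]) (use elim pq u z in auto)
    then show "norm (U (p y) (q y) (u y) - U (p z) (q z) (u z)) \<le> M * exp (\<omega> * (p y - q y)) * norm (u y - u z) +
        norm (U (p y) (q y) (u z) - U (p z) (q z) (u z))"
      using M[OF pq(3)[OF elim] subspace_diff[OF E u(2)[OF elim] u(2)[OF z]]]
        norm_triangle_ineq[of "U (p y) (q y) (u y) - U (p y) (q y) (u z)" "U (p y) (q y) (u z) - U (p z) (q z) (u z)"]
      by simp
  qed
qed

section \<open>Convolution with a stable evolution family\<close>

lemma integral_average_tendsto: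
  fixes f :: "real \<Rightarrow> real \<Rightarrow> 'a::banach"
  assumes cont: "continuous_on {(t', s). s \<le> t'} (\<lambda>(t', s). f t' s)"
  shows "((\<lambda>h. integral {t..t + h} (f (t + h)) /\<^sub>R h) \<longlongrightarrow> f t t) (at_right 0)"
proof (rule tendstoI)
  fix e :: real assume "e > 0"
  obtain d where d: "d > 0" "\<And>t' s. s \<le> t' \<Longrightarrow> dist (t', s) (t, t) < d \<Longrightarrow> dist (f t' s) (f t t) < e / 2"
    using continuous_on_iff[THEN iffD1, OF cont, rule_format, of "(t, t)" "e / 2"] \<open>e > 0\<close> by auto
  have "dist (integral {t..t + h} (f (t + h)) /\<^sub>R h) (f t t) < e" if h: "0 < h" "h < d / 2" for h
  proof -
    have "continuous_on {t..t + h} (\<lambda>s. case (t + h, s) of (t', s) \<Rightarrow> f t' s)"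
      by (rule continuous_on_compose2[OF cont continuous_on_Pair[OF continuous_on_const continuous_on_id]]) auto
    then have cont_h: "continuous_on {t..t + h} (f (t + h))"
      by simp
    have "integral {t..t + h} (\<lambda>s. f (t + h) s - f t t) = integral {t..t + h} (f (t + h)) - h *\<^sub>R f t t"
      using h by (subst integral_diff) (auto intro!: integrable_continuous_interval cont_h)
    moreover have "norm (integral {t..t + h} (\<lambda>s. f (t + h) s - f t t)) \<le> e / 2 * (t + h - t)"
    proof (rule integral_bound)
      fix s assume s: "s \<in> {t..t + h}"
      have "dist (t + h, s) (t, t) \<le> dist (t + h) t + dist s t"
        using sqrt_sum_squares_le_sum_abs[of "dist (t + h) t" "dist s t"] by (simp add: dist_Pair_Pair)
      also have "\<dots> < d"
        using s h by (simp add: dist_real_def)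
      finally show "norm (f (t + h) s - f t t) \<le> e / 2"
        using d(2)[of s "t + h"] s by (simp add: dist_norm)
    qed (use h in \<open>auto intro!: continuous_intros cont_h\<close>)
    moreover have "e / 2 * (t + h - t) < e * h"
      using mult_strict_right_mono[of "e / 2" e h] h \<open>e > 0\<close> by simp
    ultimately have "norm (integral {t..t + h} (f (t + h)) - h *\<^sub>R f t t) < e * h"
      by simp
    moreover have "integral {t..t + h} (f (t + h)) /\<^sub>R h - f t t = (integral {t..t + h} (f (t + h)) - h *\<^sub>R f t t) /\<^sub>R h"
      using h by (simp add: scaleR_diff_right)
    ultimately show ?thesis
      using h by (simp only: dist_norm norm_scaleR) (simp add: field_simps)
  qed
  then show "eventually (\<lambda>h. dist (integral {t..t + h} (f (t + h)) /\<^sub>R h) (f t t) < e) (at_right 0)"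
    using \<open>d > 0\<close> by (auto simp: eventually_at_right_field intro!: exI[of _ "d / 2"])
qed

locale mild_evolution =
  fixes D :: "'a::banach set" and A :: "'a \<Rightarrow> 'a" and M\<^sub>A \<omega>\<^sub>A \<kappa> :: real
    and G :: "real \<Rightarrow> 'a \<Rightarrow> 'a" and U :: "real \<Rightarrow> real \<Rightarrow> 'a \<Rightarrow> 'a"
  assumes hille_yosida: "hille_yosida UNIV D A M\<^sub>A \<omega>\<^sub>A"
    and \<kappa>: "\<kappa> \<in> resolvent_set UNIV D A"
    and G: "almost_periodic {f. bounded_op (closure D) UNIV f} (op_dist (closure D)) G"
    and solution: "solution_family D A G U"
begin

abbreviation "X0 \<equiv> closure D"
abbreviation "R \<equiv> resolvent D A \<kappa>"

text \<open>Along mild solutions \<open>u\<close> one has \<open>(R u)' = K(t) u\<close>.\<close>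

definition K :: "real \<Rightarrow> 'a \<Rightarrow> 'a" where
  "K t x = \<kappa> *\<^sub>R R x - x + R (G t x)"

sublocale R: bounded_linear R
  by (rule bounded_linear_resolvent[OF \<kappa>])

lemma subspace_X0: "subspace X0"
  using hille_yosida by (intro subspace_closure) (simp add: hille_yosida_def)

lemma evolution: "evolution_family X0 U"
  using solution by (simp add: solution_family_def)

lemma bounded_op_U: "s \<le> t \<Longrightarrow> bounded_op X0 X0 (U t s)"
  using evolution by (simp add: evolution_family_def)

lemma U_cocycle: "s \<le> r \<Longrightarrow> r \<le> t \<Longrightarrow> x \<in> X0 \<Longrightarrow> U t r (U r s x) = U t s x"
  using evolution unfolding evolution_family_def by metis

lemma bounded_op_G: "bounded_op X0 UNIV (G t)"
  using G by (simp add: almost_periodic_def)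

lemma K_bounded:
  obtains C where "\<And>t x. x \<in> X0 \<Longrightarrow> norm (K t x) \<le> C * norm x"
proof -
  obtain C\<^sub>G where C\<^sub>G: "\<And>t x. x \<in> X0 \<Longrightarrow> norm (G t x) \<le> C\<^sub>G * norm x"
    using almost_periodic_op_bounded[OF G subspace_X0] by blast
  obtain C\<^sub>R where C\<^sub>R: "C\<^sub>R > 0" "\<And>x. norm (R x) \<le> norm x * C\<^sub>R"
    using R.pos_bounded by blast
  have "norm (K t x) \<le> (\<bar>\<kappa>\<bar> * C\<^sub>R + 1 + C\<^sub>G * C\<^sub>R) * norm x" if "x \<in> X0" for t x
  proof -
    have "norm (K t x) \<le> norm (\<kappa> *\<^sub>R R x) + norm x + norm (R (G t x))"
      unfolding K_def by (intro norm_triangle_le add_mono norm_triangle_ineq4 order_refl)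
    also have "\<dots> \<le> \<bar>\<kappa>\<bar> * (norm x * C\<^sub>R) + norm x + C\<^sub>G * norm x * C\<^sub>R"
      using C\<^sub>R(2)[of x] order_trans[OF C\<^sub>R(2) mult_right_mono[OF C\<^sub>G[OF that, of t]]] C\<^sub>R(1)
      by (auto intro!: add_mono mult_left_mono)
    finally show ?thesis
      by (simp add: algebra_simps)
  qed
  then show ?thesis
    by (rule that)
qed

lemma bounded_op_K: "bounded_op X0 UNIV (K t)"
proof -
  obtain C where "\<And>t x. x \<in> X0 \<Longrightarrow> norm (K t x) \<le> C * norm x"
    by (rule K_bounded) blast
  moreover have "linear_op X0 UNIV (K t)"
    using bounded_opD[OF bounded_op_G[of t]]
    by (simp add: linear_op_def K_def R.add R.scaleR algebra_simps)
  ultimately show ?thesis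
    unfolding bounded_op_def by blast
qed

lemma continuous_on_K:
  assumes "continuous_on I u" "\<And>t. t \<in> I \<Longrightarrow> u t \<in> X0"
  shows "continuous_on I (\<lambda>t. K t (u t))"
  unfolding K_def
  by (intro continuous_intros R.continuous_on almost_periodic_op_continuous_on[OF G subspace_X0] assms)

lemma continuous_on_U:
  assumes "continuous_on I p" "continuous_on I q" "\<And>z. z \<in> I \<Longrightarrow> q z \<le> p z"
    "continuous_on I u" "\<And>z. z \<in> I \<Longrightarrow> u z \<in> X0"
  shows "continuous_on I (\<lambda>z. U (p z) (q z) (u z))"
proof -
  obtain \<omega> where \<omega>: "exponentially_bounded X0 U \<omega>"
    using solution by (auto simp: solution_family_def)
  show ?thesis
    by (rule evolution_family_continuous_on[OF evolution \<omega> subspace_X0 assms])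
qed

lemma resolvent_U:
  assumes x: "x \<in> X0" and "r \<le> t"
  shows "R (U t r x) - R x = integral {r..t} (\<lambda>s. K s (U s r x))"
proof -
  have mem: "U s r x \<in> X0" if "r \<le> s" for s
    using bounded_op_in[OF bounded_op_U[OF that] x] .
  have cont: "continuous_on {r..} (\<lambda>s. U s r x)"
    by (intro continuous_on_U continuous_intros) (auto simp: x)
  have "mild_solution D A G r x (\<lambda>s. U s r x)"
    using solution x by (simp add: solution_family_def)
  then have "\<forall>t\<ge>r. R (U t r x) - R x =
      integral {r..t} (\<lambda>s. \<kappa> *\<^sub>R R (U s r x) - U s r x + R (G s (U s r x)))"
    by (subst (asm) mild_solution_iff[OF \<kappa> cont])
       (auto intro!: mem almost_periodic_op_continuous_on[OF G subspace_X0 cont])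
  then show ?thesis
    using \<open>r \<le> t\<close> by (simp add: K_def)
qed

lemma resolvent_U_right_derivative:
  assumes x: "x \<in> X0"
  shows "((\<lambda>h. (R (U (t + h) t x) - R x) /\<^sub>R h) \<longlongrightarrow> K t x) (at_right 0)"
proof -
  let ?I = "\<lambda>u. integral {t..u} (\<lambda>s. K s (U s t x))"
  have "continuous_on {t..t + 1} (\<lambda>s. U s t x)"
    by (intro continuous_on_U continuous_intros) (auto simp: x)
  then have "continuous_on {t..t + 1} (\<lambda>s. K s (U s t x))"
    using x by (intro continuous_on_K) (auto intro: bounded_op_in[OF bounded_op_U])
  then have "(?I has_vector_derivative K t (U t t x)) (at t within {t..t + 1})"
    by (rule integral_has_vector_derivative) simp
  then have "((\<lambda>h. (?I (t + h) - ?I t) /\<^sub>R h) \<longlongrightarrow> K t (U t t x)) (at_right 0)"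
    by (rule has_vector_derivative_imp_right_quotient) simp
  moreover have "U t t x = x"
    using evolution x by (simp add: evolution_family_def)
  moreover have "eventually (\<lambda>h. (?I (t + h) - ?I t) /\<^sub>R h = (R (U (t + h) t x) - R x) /\<^sub>R h) (at_right 0)"
    using eventually_at_right_less[of "0::real"] by eventually_elim (simp add: resolvent_U[OF x])
  ultimately show ?thesis
    using Lim_transform_eventually by fastforce
qed

end

locale stable_convolution = mild_evolution +
  fixes \<delta> M C :: real and g :: "real \<Rightarrow> 'a"
  assumes \<delta>: "\<delta> > 0" and M: "M \<ge> 1"
    and U_bound: "\<And>s t x. s \<le> t \<Longrightarrow> x \<in> X0 \<Longrightarrow> norm (U t s x) \<le> M * exp (- \<delta> * (t - s)) * norm x"
    and g_cont: "continuous_on UNIV g" and g_mem: "\<And>t. g t \<in> X0"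
    and g_bound: "\<And>t. norm (g t) \<le> C"
begin

definition y :: "real \<Rightarrow> 'a" where
  "y t = integral {..t} (\<lambda>s. U t s (g s))"

lemma U_g_mem: "s \<le> t \<Longrightarrow> U t s (g s) \<in> X0"
  by (rule bounded_op_in[OF bounded_op_U g_mem])

lemma U_g_continuous_on: "continuous_on {(t, s). s \<le> t} (\<lambda>(t, s). U t s (g s))"
  unfolding case_prod_unfold
  by (intro continuous_on_U continuous_intros continuous_on_compose2[OF g_cont]) (auto simp: g_mem)

lemma U_g_continuous_on_fst: "continuous_on {..t} (\<lambda>s. U t s (g s))"
  by (intro continuous_on_U continuous_intros continuous_on_subset[OF g_cont]) (auto simp: g_mem)

lemma U_g_bound:
  assumes "s \<le> t"
  shows "norm (U t s (g s)) \<le> M * C * exp (\<delta> * (s - t))"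
proof -
  have "norm (U t s (g s)) \<le> M * exp (- \<delta> * (t - s)) * norm (g s)"
    by (intro U_bound assms g_mem)
  also have "\<dots> \<le> M * exp (- \<delta> * (t - s)) * C"
    using M by (intro mult_left_mono g_bound) auto
  finally show ?thesis
    by (simp add: algebra_simps)
qed

lemma y_tendsto: "((\<lambda>a. integral {a..t} (\<lambda>s. U t s (g s))) \<longlongrightarrow> y t) at_bot"
  unfolding y_def using \<delta> U_g_continuous_on_fst U_g_bound by (rule integral_atMost_exp_decay)

lemma integral_U_g_mem: "b \<le> t \<Longrightarrow> integral {a..b} (\<lambda>s. U t s (g s)) \<in> X0"
  by (intro integral_in_closed_subspace[OF subspace_X0 closed_closure] integrable_continuous_interval
      continuous_on_subset[OF U_g_continuous_on_fst]) (auto intro: U_g_mem)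

lemma y_mem: "y t \<in> X0"
  using closed_closure _ trivial_limit_at_bot_linorder y_tendsto[of t]
  by (rule Lim_in_closed_set) (simp add: integral_U_g_mem)

lemma y_bound: "norm (y t) \<le> M * C / \<delta>"
proof (rule Lim_norm_ubound[OF trivial_limit_at_bot_linorder y_tendsto])
  have "C \<ge> 0"
    using order_trans[OF norm_ge_zero g_bound] .
  show "eventually (\<lambda>a. norm (integral {a..t} (\<lambda>s. U t s (g s))) \<le> M * C / \<delta>) at_bot"
    using eventually_le_at_bot[of t]
  proof eventually_elim
    case (elim a)
    have "norm (integral {a..t} (\<lambda>s. U t s (g s))) \<le> M * C / \<delta> * exp (\<delta> * (t - t))"
      using elim \<delta> M \<open>C \<ge> 0\<close>
      by (intro integral_exp_decay_bound continuous_on_subset[OF U_g_continuous_on_fst] U_g_bound) auto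
    then show ?case
      by simp
  qed
qed

lemma y_cocycle:
  assumes "r \<le> t"
  shows "y t = U t r (y r) + integral {r..t} (\<lambda>s. U t s (g s))"
proof (rule tendsto_unique[OF trivial_limit_at_bot_linorder y_tendsto])
  have "((\<lambda>a. U t r (integral {a..r} (\<lambda>s. U r s (g s)))) \<longlongrightarrow> U t r (y r)) at_bot"
    by (rule bounded_op_tendsto[OF bounded_op_U[OF assms] subspace_X0 y_tendsto])
       (simp_all add: integral_U_g_mem y_mem)
  then have lim: "((\<lambda>a. U t r (integral {a..r} (\<lambda>s. U r s (g s))) + integral {r..t} (\<lambda>s. U t s (g s)))
      \<longlongrightarrow> U t r (y r) + integral {r..t} (\<lambda>s. U t s (g s))) at_bot"
    by (intro tendsto_intros)
  have "eventually (\<lambda>a. U t r (integral {a..r} (\<lambda>s. U r s (g s))) + integral {r..t} (\<lambda>s. U t s (g s)) =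
      integral {a..t} (\<lambda>s. U t s (g s))) at_bot"
    using eventually_le_at_bot[of r]
  proof eventually_elim
    case (elim a)
    have "U t r (integral {a..r} (\<lambda>s. U r s (g s))) = integral {a..r} (\<lambda>s. U t r (U r s (g s)))"
      by (rule bounded_op_integral[OF bounded_op_U[OF assms] subspace_X0 closed_closure])
         (auto intro: continuous_on_subset[OF U_g_continuous_on_fst] U_g_mem)
    also have "\<dots> = integral {a..r} (\<lambda>s. U t s (g s))"
    proof (rule integral_cong)
      fix s assume "s \<in> {a..r}"
      then show "U t r (U r s (g s)) = U t s (g s)"
        using assms by (simp add: U_cocycle g_mem)
    qed
    finally show ?case
      using Henstock_Kurzweil_Integration.integral_combine[OF elim assms
          integrable_continuous_interval[OF continuous_on_subset[OF U_g_continuous_on_fst]]]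
      by auto
  qed
  with lim show "((\<lambda>a. integral {a..t} (\<lambda>s. U t s (g s)))
      \<longlongrightarrow> U t r (y r) + integral {r..t} (\<lambda>s. U t s (g s))) at_bot"
    by (rule Lim_transform_eventually)
qed

lemma y_continuous_on: "continuous_on {r..b} y"
proof -
  let ?f = "\<lambda>t s. U (max t s) s (g s)"
  have f_cont: "continuous_on (I :: (real \<times> real) set) (\<lambda>(t, s). ?f t s)" for I
    unfolding case_prod_unfold
    by (intro continuous_on_U continuous_intros continuous_on_compose2[OF g_cont]) (auto simp: g_mem)
  have "continuous_on {r..b} (\<lambda>t. U t r (y r) + (integral (cbox r b) (?f t) - (integral {r..b} g - integral {r..t} g)))"
    by (intro continuous_intros continuous_on_U integral_continuous_on_param f_cont
        indefinite_integral_continuous_1 integrable_continuous_interval continuous_on_subset[OF g_cont])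
       (auto simp: y_mem)
  moreover have "U t r (y r) + (integral (cbox r b) (?f t) - (integral {r..b} g - integral {r..t} g)) = y t"
    if t: "t \<in> {r..b}" for t
  proof -
    have int: "?f t integrable_on {r..b}" "g integrable_on {r..b}"
      by (intro integrable_continuous_interval continuous_on_U continuous_intros
          continuous_on_subset[OF g_cont]; auto simp: g_mem)+
    have "integral {r..b} (?f t) = integral {r..t} (?f t) + integral {t..b} (?f t)"
      using Henstock_Kurzweil_Integration.integral_combine[OF _ _ int(1), of t] t by simp
    moreover have "integral {r..t} (?f t) = integral {r..t} (\<lambda>s. U t s (g s))"
      by (rule integral_cong) (simp add: max_absorb1)
    moreover have "integral {t..b} (?f t) = integral {t..b} g"
      using evolution g_mem by (intro integral_cong) (auto simp: evolution_family_def max_def)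
    moreover have "integral {r..b} g = integral {r..t} g + integral {t..b} g"
      using Henstock_Kurzweil_Integration.integral_combine[OF _ _ int(2), of t] t by simp
    ultimately show ?thesis
      using y_cocycle[of r t] t by simp
  qed
  ultimately show ?thesis
    by (rule continuous_on_eq)
qed

lemma resolvent_y_right_derivative:
  "((\<lambda>h. (R (y (t + h)) - R (y t)) /\<^sub>R h) \<longlongrightarrow> K t (y t) + R (g t)) (at_right 0)"
proof -
  have "U t t (g t) = g t"
    using evolution g_mem by (simp add: evolution_family_def)
  then have "((\<lambda>h. integral {t..t + h} (\<lambda>s. U (t + h) s (g s)) /\<^sub>R h) \<longlongrightarrow> g t) (at_right 0)"
    using integral_average_tendsto[OF U_g_continuous_on, of t] by simp
  from tendsto_add[OF resolvent_U_right_derivative[OF y_mem] R.tendsto[OF this]]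
  have lim: "((\<lambda>h. (R (U (t + h) t (y t)) - R (y t)) /\<^sub>R h + R (integral {t..t + h} (\<lambda>s. U (t + h) s (g s)) /\<^sub>R h))
      \<longlongrightarrow> K t (y t) + R (g t)) (at_right 0)" .
  have "eventually (\<lambda>h. (R (U (t + h) t (y t)) - R (y t)) /\<^sub>R h + R (integral {t..t + h} (\<lambda>s. U (t + h) s (g s)) /\<^sub>R h) =
      (R (y (t + h)) - R (y t)) /\<^sub>R h) (at_right 0)"
    using eventually_at_right_less[of "0::real"]
  proof eventually_elim
    case (elim h)
    then show ?case
      using y_cocycle[of t "t + h"] by (simp add: R.add R.scaleR scaleR_add_right scaleR_diff_right)
  qed
  with lim show ?thesis
    by (rule Lim_transform_eventually)
qed

lemma resolvent_y:
  assumes "a \<le> b"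
  shows "R (y b) - R (y a) = integral {a..b} (\<lambda>s. K s (y s) + R (g s))"
  using assms
proof (rule right_derivative_imp_integral)
  show "continuous_on {a..b} (\<lambda>t. R (y t))"
    by (intro R.continuous_on y_continuous_on)
  show "continuous_on {a..b} (\<lambda>s. K s (y s) + R (g s))"
    by (intro continuous_intros continuous_on_K y_continuous_on y_mem R.continuous_on
        continuous_on_subset[OF g_cont] subset_UNIV)
qed (rule resolvent_y_right_derivative)

end

section \<open>Generators of strongly continuous semigroups\<close>

lemma C0_semigroup_generator_quotient:
  assumes T: "C0_semigroup E T" and E: "subspace E" and gen: "is_generator E T Dom B"
    and x: "x \<in> Dom" and "0 \<le> t"
  shows "T t x \<in> Dom" and "((\<lambda>h. (T (t + h) x - T t x) /\<^sub>R h) \<longlongrightarrow> B (T t x)) (at_right 0)"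
proof -
  have bop: "bounded_op E E (T s)" if "0 \<le> s" for s
    using T that by (simp add: C0_semigroup_def)
  obtain y where y: "x \<in> E" "y \<in> E" "((\<lambda>h. (T h x - x) /\<^sub>R h) \<longlongrightarrow> y) (at_right 0)"
    using gen x by (auto simp: is_generator_def)
  have pos: "eventually (\<lambda>h::real. 0 < h) (at_right 0)"
    by (rule eventually_at_right_less)
  have lim: "((\<lambda>h. T t ((T h x - x) /\<^sub>R h)) \<longlongrightarrow> T t y) (at_right 0)"
  proof (rule bounded_op_tendsto[OF bop[OF \<open>0 \<le> t\<close>] E y(3) _ y(2)])
    show "eventually (\<lambda>h. (T h x - x) /\<^sub>R h \<in> E) (at_right 0)"
      using pos
    proof eventually_elim
      case (elim h)
      then show ?case
        using bounded_op_in[OF bop[of h] y(1)] y(1) E by (simp add: subspace_diff subspace_scale)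
    qed
  qed
  have eq: "eventually (\<lambda>h. T t ((T h x - x) /\<^sub>R h) = (T h (T t x) - T t x) /\<^sub>R h \<and>
      T (t + h) x = T h (T t x)) (at_right 0)"
    using pos
  proof eventually_elim
    case (elim h)
    have "T h x \<in> E"
      using bounded_op_in[OF bop[of h] y(1)] elim by simp
    moreover have "T t (T h x) = T (t + h) x" "T h (T t x) = T (h + t) x"
      using T \<open>0 \<le> t\<close> elim y(1) by (simp_all add: C0_semigroup_def)
    ultimately show ?case
      using bop[OF \<open>0 \<le> t\<close>] y(1) E
      by (simp add: bounded_op_scaleR bounded_op_diff subspace_diff add.commute)
  qed
  have lim': "((\<lambda>h. (T h (T t x) - T t x) /\<^sub>R h) \<longlongrightarrow> T t y) (at_right 0)"
    by (rule Lim_transform_eventually[OF lim]) (use eq in \<open>auto elim: eventually_mono\<close>)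
  then show "T t x \<in> Dom"
    using gen bounded_op_in[OF bop[OF \<open>0 \<le> t\<close>]] y(1,2) unfolding is_generator_def by blast
  then have "((\<lambda>h. (T h (T t x) - T t x) /\<^sub>R h) \<longlongrightarrow> B (T t x)) (at_right 0)"
    using gen by (simp add: is_generator_def)
  then show "((\<lambda>h. (T (t + h) x - T t x) /\<^sub>R h) \<longlongrightarrow> B (T t x)) (at_right 0)"
    by (rule Lim_transform_eventually) (use eq in \<open>auto elim: eventually_mono\<close>)
qed

lemma C0_semigroup_generator_dense:
  fixes T :: "real \<Rightarrow> 'a::banach \<Rightarrow> 'a"
  assumes T: "C0_semigroup E T" and E: "subspace E" "closed E" and gen: "is_generator E T Dom B"
  shows "E \<subseteq> closure Dom"
proof
  fix x assume x: "x \<in> E"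
  have bop: "bounded_op E E (T s)" if "0 \<le> s" for s
    using T that by (simp add: C0_semigroup_def)
  have cont: "continuous_on {0..} (\<lambda>t. T t x)" and T0: "T 0 x = x"
    using T x by (simp_all add: C0_semigroup_def)
  have cont_sub: "continuous_on {a..b} (\<lambda>t. T t x)" if "0 \<le> a" for a b
    using cont by (rule continuous_on_subset) (use that in auto)
  define J where "J h = integral {0..h} (\<lambda>s. T s x)" for h
  have J_mem: "J h \<in> E" for h
    unfolding J_def using bounded_op_in[OF bop x]
    by (intro integral_in_closed_subspace[OF E] integrable_continuous_interval cont_sub) auto
  have J_deriv: "((\<lambda>h. (J (t + h) - J t) /\<^sub>R h) \<longlongrightarrow> T t x) (at_right 0)" if "0 \<le> t" for t
  proof (rule has_vector_derivative_imp_right_quotient)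
    have "(J has_vector_derivative T t x) (at t within {0..t + 1})"
      unfolding J_def using that by (intro integral_has_vector_derivative cont_sub) auto
    then show "(J has_vector_derivative T t x) (at t within {t..t + 1})"
      by (rule has_vector_derivative_within_subset) (use that in auto)
  qed simp
  have J_dom: "J t /\<^sub>R t \<in> Dom" if "0 < t" for t
  proof -
    have "((\<lambda>h. ((J (t + h) - J t) /\<^sub>R h - (J (0 + h) - J 0) /\<^sub>R h) /\<^sub>R t) \<longlongrightarrow> (T t x - T 0 x) /\<^sub>R t) (at_right 0)"
      using that by (intro tendsto_intros J_deriv) auto
    moreover have "eventually (\<lambda>h. ((J (t + h) - J t) /\<^sub>R h - (J (0 + h) - J 0) /\<^sub>R h) /\<^sub>R t =
        (T h (J t /\<^sub>R t) - J t /\<^sub>R t) /\<^sub>R h) (at_right 0)"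
      using eventually_at_right_less[of "0::real"]
    proof eventually_elim
      case (elim h)
      have "T h (J t) = integral {0..t} (\<lambda>s. T h (T s x))"
        unfolding J_def using elim bounded_op_in[OF bop x]
        by (intro bounded_op_integral[OF bop E] cont_sub) auto
      also have "\<dots> = integral {0..t} (\<lambda>s. T (s + h) x)"
      proof (rule integral_cong)
        fix s assume "s \<in> {0..t}"
        then have "T (h + s) x = T h (T s x)"
          using T x elim by (simp add: C0_semigroup_def)
        then show "T h (T s x) = T (s + h) x"
          by (simp add: add.commute)
      qed
      also have "\<dots> = integral {h..t + h} (\<lambda>s. T s x)"
        using integral_shift_real_ivl[of h h "t + h" "\<lambda>s. T s x"] by simp
      also have "\<dots> = J (t + h) - J h"
        using Henstock_Kurzweil_Integration.integral_combine[OF _ _ integrable_continuous_interval[OF cont_sub],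
            of 0 h "t + h"] elim that by (simp add: J_def eq_diff_eq add.commute)
      finally have "T h (J t) = J (t + h) - J h" .
      moreover have "J 0 = 0"
        by (simp add: J_def)
      ultimately show ?case
        using bop[of h] elim J_mem[of t]
        by (simp add: bounded_op_scaleR scaleR_diff_right mult.commute)
    qed
    ultimately have "((\<lambda>h. (T h (J t /\<^sub>R t) - J t /\<^sub>R t) /\<^sub>R h) \<longlongrightarrow> (T t x - T 0 x) /\<^sub>R t) (at_right 0)"
      by (rule Lim_transform_eventually)
    moreover have "(T t x - T 0 x) /\<^sub>R t \<in> E"
      using bounded_op_in[OF bop x] that E(1) by (intro subspace_scale subspace_diff) auto
    moreover have "J t /\<^sub>R t \<in> E"
      by (intro subspace_scale E J_mem)
    ultimately show ?thesis
      using gen unfolding is_generator_def by blast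
  qed
  have "eventually (\<lambda>t. J t /\<^sub>R t \<in> closure Dom) (at_right 0)"
    using eventually_at_right_less[of "0::real"]
    by eventually_elim (use J_dom closure_subset in blast)
  moreover have "((\<lambda>t. J t /\<^sub>R t) \<longlongrightarrow> x) (at_right 0)"
    using J_deriv[of 0] by (simp add: T0 J_def)
  ultimately show "x \<in> closure Dom"
    by (intro Lim_in_closed_set[OF closed_closure _ trivial_limit_at_right_real])
qed

lemma almost_periodic_op_uminus:
  assumes "almost_periodic {f. bounded_op S UNIV f} (op_dist S) V"
  shows "almost_periodic {f. bounded_op S UNIV f} (op_dist S) (\<lambda>t x. - V t x)"
proof -
  have "op_dist S (\<lambda>x. - f x) (\<lambda>x. - g x) = op_dist S f g" for f g :: "'a \<Rightarrow> 'b"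
  proof -
    have "norm (- f x - - g x) = norm (f x - g x)" for x
      by (metis minus_diff_minus norm_minus_cancel)
    then show ?thesis
      by (simp add: op_dist_def op_norm_def)
  qed
  moreover have "bounded_op S UNIV (\<lambda>x. - f x)" if "bounded_op S UNIV f" for f :: "'a \<Rightarrow> 'b"
    using that by (auto simp: bounded_op_def linear_op_def)
  ultimately show ?thesis
    using assms by (simp add: almost_periodic_def translation_set_def)
qed

section \<open>Identification of the semigroups\<close>

instance bcontfun :: (metric_space, banach) banach ..

lemma AP_resolvent_operator_at_zero:
  fixes D :: "'a::banach set"
  assumes B: "AP_resolvent_operator D A U DB B" and neg: "growth_bound (closure D) U < 0"
  shows "0 \<in> resolvent_set (AP UNIV) DB B" "\<psi> \<in> DB \<Longrightarrow> - B \<psi> \<in> AP UNIV"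
    "subspace (AP (UNIV :: 'a::banach set))"
proof -
  show 0: "0 \<in> resolvent_set (AP UNIV) DB B"
    using B neg by (simp add: AP_resolvent_operator_def zero_ereal_def)
  have img: "(\<lambda>\<psi>. 0 *\<^sub>R \<psi> - B \<psi>) ` DB = AP UNIV"
    using 0 unfolding resolvent_set_def by (auto dest: bij_betw_imp_surj_on)
  show "- B \<psi> \<in> AP UNIV" if "\<psi> \<in> DB"
    using that by (simp add: img[symmetric])
  have DB: "subspace DB" "linear_op DB (AP UNIV) B"
    using B by (auto simp: AP_resolvent_operator_def hille_yosida_def)
  show "subspace (AP (UNIV :: 'a set))"
    unfolding img[symmetric]
  proof (rule subspaceI)
    have "B 0 = 0"
      using DB subspace_0[OF DB(1)] unfolding linear_op_def by (metis scaleR_zero_left)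
    then show "0 \<in> (\<lambda>\<psi>. 0 *\<^sub>R \<psi> - B \<psi>) ` DB"
      using subspace_0[OF DB(1)] by (intro image_eqI[of _ _ 0]) simp_all
  next
    fix x y assume "x \<in> (\<lambda>\<psi>. 0 *\<^sub>R \<psi> - B \<psi>) ` DB" "y \<in> (\<lambda>\<psi>. 0 *\<^sub>R \<psi> - B \<psi>) ` DB"
    then obtain u v where "x = - B u" "u \<in> DB" "y = - B v" "v \<in> DB"
      by auto
    then show "x + y \<in> (\<lambda>\<psi>. 0 *\<^sub>R \<psi> - B \<psi>) ` DB"
      using DB by (intro image_eqI[of _ _ "u + v"]) (simp_all add: linear_op_def subspace_add)
  next
    fix c x assume "x \<in> (\<lambda>\<psi>. 0 *\<^sub>R \<psi> - B \<psi>) ` DB"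
    then obtain u where "x = - B u" "u \<in> DB"
      by auto
    then show "c *\<^sub>R x \<in> (\<lambda>\<psi>. 0 *\<^sub>R \<psi> - B \<psi>) ` DB"
      using DB by (intro image_eqI[of _ _ "c *\<^sub>R u"]) (simp_all add: linear_op_def subspace_scale)
  qed
qed

context mild_evolution
begin

text \<open>The approximants \<open>\<psi>\<^sub>n\<close> are only known to converge pointwise, so the integral
  equation for \<open>R \<psi>\<close> is obtained from that for \<open>R \<psi>\<^sub>n\<close> by dominated convergence.\<close>

lemma AP_resolvent_operator_integral:
  assumes B: "AP_resolvent_operator D A U DB B" and neg: "growth_bound X0 U < 0"
    and \<psi>: "\<psi> \<in> DB" and "a \<le> b"
  shows "R (apply_bcontfun \<psi> b) - R (apply_bcontfun \<psi> a) =
    integral {a..b} (\<lambda>s. K s (apply_bcontfun \<psi> s) - R (apply_bcontfun (B \<psi>) s))"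
proof -
  define \<phi> where "\<phi> = - B \<psi>"
  obtain \<omega> where \<omega>: "exponentially_bounded X0 U \<omega>" "\<omega> < 0"
    using neg by (auto simp: growth_bound_def Inf_less_iff)
  obtain M where M: "M \<ge> 1" "\<And>s t x. s \<le> t \<Longrightarrow> x \<in> X0 \<Longrightarrow> norm (U t s x) \<le> M * exp (\<omega> * (t - s)) * norm x"
    using evolution_family_bound[OF evolution \<omega>(1) subspace_X0] by blast
  have \<psi>_mem: "apply_bcontfun \<psi> t \<in> X0" for t
    using B \<psi> by (auto simp: AP_resolvent_operator_def intro: AP_in)
  have \<psi>_eq: "resolvent DB B 0 \<phi> = \<psi>"
    using resolvent_left_inverse[OF AP_resolvent_operator_at_zero(1)[OF B neg] \<psi>] by (simp add: \<phi>_def)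
  obtain N\<^sub>0 where N\<^sub>0: "\<And>\<mu> x. \<mu> \<ge> N\<^sub>0 \<Longrightarrow> norm (\<mu> *\<^sub>R resolvent D A \<mu> x) \<le> 2 * M\<^sub>A * norm x"
    using hille_yosida_scaled_resolvent_bound[OF hille_yosida] by (auto simp: eventually_at_top_linorder)
  define \<mu> where "\<mu> n = max N\<^sub>0 (\<omega>\<^sub>A + 1) + real n" for n
  have \<mu>: "\<mu> n \<ge> N\<^sub>0" "\<mu> n \<in> resolvent_set UNIV D A" for n
    using hille_yosida by (auto simp: \<mu>_def hille_yosida_def)
  have \<mu>_lim: "filterlim \<mu> at_top sequentially"
    unfolding \<mu>_def by (intro filterlim_tendsto_add_at_top[OF tendsto_const] filterlim_real_sequentially)
  define g where "g n s = \<mu> n *\<^sub>R resolvent D A (\<mu> n) (apply_bcontfun \<phi> s)" for n s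
  define C where "C = 2 * M\<^sub>A * norm \<phi>"
  have M\<^sub>A: "M\<^sub>A \<ge> 1"
    using hille_yosida by (simp add: hille_yosida_def)
  interpret conv: stable_convolution D A M\<^sub>A \<omega>\<^sub>A \<kappa> G U "- \<omega>" M C "g n" for n
  proof
    show "continuous_on UNIV (g n)"
      unfolding g_def by (intro continuous_intros bounded_linear.continuous_on[OF bounded_linear_resolvent[OF \<mu>(2)]]) simp
    show "g n t \<in> X0" for t
    proof -
      have "resolvent D A (\<mu> n) (apply_bcontfun \<phi> t) \<in> X0"
        using resolvent_in[OF \<mu>(2)] closure_subset by blast
      then show ?thesis
        unfolding g_def by (rule subspace_scale[OF subspace_X0])
    qed
    show "norm (g n t) \<le> C" for t
    proof -
      have "norm (g n t) \<le> 2 * M\<^sub>A * norm (apply_bcontfun \<phi> t)"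
        unfolding g_def by (rule N\<^sub>0[OF \<mu>(1)])
      also have "\<dots> \<le> C"
        unfolding C_def using M\<^sub>A by (intro mult_left_mono norm_bounded) auto
      finally show ?thesis .
    qed
  qed (use \<omega> M in auto)
  have y_lim: "(\<lambda>n. conv.y n t) \<longlonglongrightarrow> apply_bcontfun \<psi> t" for t
  proof -
    have "((\<lambda>\<mu>. integral {..t} (\<lambda>s. exp (- 0 * (t - s)) *\<^sub>R
        U t s (\<mu> *\<^sub>R resolvent D A \<mu> (apply_bcontfun \<phi> s)))) \<longlongrightarrow> apply_bcontfun (resolvent DB B 0 \<phi>) t) at_top"
      using B neg AP_resolvent_operator_at_zero(2)[OF B neg \<psi>]
      unfolding AP_resolvent_operator_def \<phi>_def[symmetric] zero_ereal_def by blast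
    then have "((\<lambda>\<mu>. integral {..t} (\<lambda>s. U t s (\<mu> *\<^sub>R resolvent D A \<mu> (apply_bcontfun \<phi> s))))
        \<longlongrightarrow> apply_bcontfun \<psi> t) at_top"
      by (simp add: \<psi>_eq)
    from filterlim_compose[OF this \<mu>_lim] show ?thesis
      by (simp add: conv.y_def g_def)
  qed
  obtain C\<^sub>K where C\<^sub>K: "\<And>t x. x \<in> X0 \<Longrightarrow> norm (K t x) \<le> C\<^sub>K * norm x"
    by (rule K_bounded) blast
  obtain C\<^sub>R where C\<^sub>R: "C\<^sub>R > 0" "\<And>x. norm (R x) \<le> norm x * C\<^sub>R"
    using R.pos_bounded by blast
  have "(\<lambda>n. integral {a..b} (\<lambda>s. K s (conv.y n s) + R (g n s))) \<longlonglongrightarrow>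
      integral {a..b} (\<lambda>s. K s (apply_bcontfun \<psi> s) + R (apply_bcontfun \<phi> s))"
  proof (rule integral_tendsto_bounded_continuous)
    show "continuous_on {a..b} (\<lambda>s. K s (conv.y n s) + R (g n s))" for n
      by (intro continuous_intros continuous_on_K conv.y_continuous_on conv.y_mem R.continuous_on
          continuous_on_subset[OF conv.g_cont] subset_UNIV)
    show "continuous_on {a..b} (\<lambda>s. K s (apply_bcontfun \<psi> s) + R (apply_bcontfun \<phi> s))"
      by (intro continuous_intros continuous_on_K R.continuous_on \<psi>_mem continuous_on_apply_bcontfun)
    fix n s
    have "norm (K s (conv.y n s) + R (g n s)) \<le> C\<^sub>K * norm (conv.y n s) + norm (g n s) * C\<^sub>R"
      using C\<^sub>K[OF conv.y_mem, of s n] C\<^sub>R(2)[of "g n s"] by (intro norm_triangle_le add_mono)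
    also have "\<dots> \<le> \<bar>C\<^sub>K\<bar> * (M * C / - \<omega>) + C * C\<^sub>R"
      using C\<^sub>R(1) by (intro add_mono mult_mono mult_right_mono conv.y_bound conv.g_bound) auto
    finally show "norm (K s (conv.y n s) + R (g n s)) \<le> \<bar>C\<^sub>K\<bar> * (M * C / - \<omega>) + C * C\<^sub>R" .
  next
    fix s
    have "(\<lambda>n. K s (conv.y n s)) \<longlonglongrightarrow> K s (apply_bcontfun \<psi> s)"
      by (rule bounded_op_tendsto[OF bounded_op_K subspace_X0 y_lim]) (simp_all add: conv.y_mem \<psi>_mem)
    moreover have "(\<lambda>n. R (g n s)) \<longlonglongrightarrow> R (apply_bcontfun \<phi> s)"
      unfolding g_def
      by (rule filterlim_compose[OF hille_yosida_resolvent_scaled_tendsto[OF hille_yosida \<kappa>] \<mu>_lim])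
    ultimately show "(\<lambda>n. K s (conv.y n s) + R (g n s)) \<longlonglongrightarrow> K s (apply_bcontfun \<psi> s) + R (apply_bcontfun \<phi> s)"
      by (rule tendsto_add)
  qed
  then have "(\<lambda>n. R (conv.y n b) - R (conv.y n a)) \<longlonglongrightarrow>
      integral {a..b} (\<lambda>s. K s (apply_bcontfun \<psi> s) + R (apply_bcontfun \<phi> s))"
    using conv.resolvent_y[OF \<open>a \<le> b\<close>] by simp
  moreover have "(\<lambda>n. R (conv.y n b) - R (conv.y n a)) \<longlonglongrightarrow> R (apply_bcontfun \<psi> b) - R (apply_bcontfun \<psi> a)"
    by (intro tendsto_intros R.tendsto y_lim)
  ultimately show ?thesis
    using LIMSEQ_unique by (fastforce simp: \<phi>_def R.neg)
qed

lemma AP_resolvent_operator_right_derivative: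
  assumes B: "AP_resolvent_operator D A U DB B" and neg: "growth_bound X0 U < 0" and \<psi>: "\<psi> \<in> DB"
  shows "((\<lambda>h. (R (apply_bcontfun \<psi> (t + h)) - R (apply_bcontfun \<psi> t)) /\<^sub>R h) \<longlongrightarrow>
    K t (apply_bcontfun \<psi> t) - R (apply_bcontfun (B \<psi>) t)) (at_right 0)"
proof -
  let ?c = "\<lambda>s. K s (apply_bcontfun \<psi> s) - R (apply_bcontfun (B \<psi>) s)"
  let ?I = "\<lambda>u. integral {t..u} ?c"
  have "apply_bcontfun \<psi> s \<in> X0" for s
    using B \<psi> by (auto simp: AP_resolvent_operator_def intro: AP_in)
  then have "continuous_on {t..t + 1} ?c"
    by (intro continuous_intros continuous_on_K R.continuous_on continuous_on_apply_bcontfun)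
  then have "(?I has_vector_derivative ?c t) (at t within {t..t + 1})"
    by (rule integral_has_vector_derivative) simp
  then have "((\<lambda>h. (?I (t + h) - ?I t) /\<^sub>R h) \<longlongrightarrow> ?c t) (at_right 0)"
    by (rule has_vector_derivative_imp_right_quotient) simp
  moreover have "eventually (\<lambda>h. (?I (t + h) - ?I t) /\<^sub>R h =
      (R (apply_bcontfun \<psi> (t + h)) - R (apply_bcontfun \<psi> t)) /\<^sub>R h) (at_right 0)"
    using eventually_at_right_less[of "0::real"]
    by eventually_elim (simp add: AP_resolvent_operator_integral[OF B neg \<psi>])
  ultimately show ?thesis
    by (rule Lim_transform_eventually)
qed

text \<open>The diagonal \<open>t \<mapsto> (T (t - a) \<psi>) t\<close> solves the equation perturbed by \<open>F\<close>: the transport part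
  \<open>- d/ds\<close> of \<open>B\<close> cancels the shift of the argument.\<close>

lemma AP_semigroup_right_derivative:
  fixes T :: "real \<Rightarrow> (real \<Rightarrow>\<^sub>C 'a) \<Rightarrow> (real \<Rightarrow>\<^sub>C 'a)"
  assumes B: "AP_resolvent_operator D A U DB B" and neg: "growth_bound X0 U < 0"
    and T: "C0_semigroup (AP X0) T" and AP: "subspace (AP X0)"
    and gen: "is_generator (AP X0) T
      (part_domain DB (\<lambda>\<psi>. B \<psi> + mult_op F \<psi>) (AP X0)) (\<lambda>\<psi>. B \<psi> + mult_op F \<psi>)"
    and F: "almost_periodic {f. bounded_op X0 UNIV f} (op_dist X0) F"
    and \<psi>: "\<psi> \<in> part_domain DB (\<lambda>\<psi>. B \<psi> + mult_op F \<psi>) (AP X0)" and "a \<le> t"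
  defines "u \<equiv> \<lambda>t. apply_bcontfun (T (t - a) \<psi>) t"
  shows "((\<lambda>h. (R (u (t + h)) - R (u t)) /\<^sub>R h) \<longlongrightarrow> K t (u t) + R (F t (u t))) (at_right 0)"
proof -
  define w where "w = T (t - a) \<psi>"
  have pos: "0 \<le> t - a"
    using \<open>a \<le> t\<close> by simp
  note w = C0_semigroup_generator_quotient[OF T AP gen \<psi> pos, folded w_def]
  have w_DB: "w \<in> DB" "w \<in> AP X0"
    using w(1) by (auto simp: part_domain_def)
  have id: "((\<lambda>h. t + h) \<longlongrightarrow> t) (at_right 0)"
    using tendsto_add[OF tendsto_const tendsto_ident_at, of t 0 "{0<..}"] by simp
  have "((\<lambda>h. R (apply_bcontfun ((T (t - a + h) \<psi> - w) /\<^sub>R h) (t + h))) \<longlongrightarrow>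
      R (apply_bcontfun (B w + mult_op F w) t)) (at_right 0)"
    by (intro R.tendsto tendsto_apply_bcontfun w(2) id)
  from tendsto_add[OF this AP_resolvent_operator_right_derivative[OF B neg w_DB(1), of t]]
  have "((\<lambda>h. R (apply_bcontfun ((T (t - a + h) \<psi> - w) /\<^sub>R h) (t + h)) +
      (R (apply_bcontfun w (t + h)) - R (apply_bcontfun w t)) /\<^sub>R h) \<longlongrightarrow>
      K t (apply_bcontfun w t) + R (F t (apply_bcontfun w t))) (at_right 0)"
    by (simp add: apply_mult_op[OF F subspace_X0 w_DB(2)] R.add add.commute)
  moreover have "R (apply_bcontfun ((T (t - a + h) \<psi> - w) /\<^sub>R h) (t + h)) +
      (R (apply_bcontfun w (t + h)) - R (apply_bcontfun w t)) /\<^sub>R h = (R (u (t + h)) - R (u t)) /\<^sub>R h" for h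
    unfolding u_def w_def by (simp add: R.diff R.scaleR scaleR_diff_right diff_add_eq)
  ultimately show ?thesis
    by (simp add: u_def w_def)
qed

end

lemma C0_semigroup_AP_diagonal_continuous_on:
  assumes "C0_semigroup (AP S) T" "\<psi> \<in> AP S"
  shows "continuous_on {a..} (\<lambda>t. apply_bcontfun (T (t - a) \<psi>) t)"
proof -
  have "continuous_on {0..} (\<lambda>t. T t \<psi>)"
    using assms by (simp add: C0_semigroup_def)
  then have "continuous_on {a..} (\<lambda>t. T (t - a) \<psi>)"
    by (rule continuous_on_compose2) (auto intro!: continuous_intros)
  then show ?thesis
    unfolding continuous_on_def by (auto intro!: tendsto_apply_bcontfun)
qed

theorem theorem3p14:
  fixes D X0 Xpos :: "'a::banach set"
    and A :: "'a \<Rightarrow> 'a"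
    and M_A \<omega>_A :: real
    and F V :: "real \<Rightarrow> 'a \<Rightarrow> 'a"
    and U \<Gamma> :: "real \<Rightarrow> real \<Rightarrow> 'a \<Rightarrow> 'a"
    and DB :: "(real \<Rightarrow>\<^sub>C 'a) set"
    and B :: "(real \<Rightarrow>\<^sub>C 'a) \<Rightarrow> (real \<Rightarrow>\<^sub>C 'a)"
    and T :: "real \<Rightarrow> (real \<Rightarrow>\<^sub>C 'a) \<Rightarrow> (real \<Rightarrow>\<^sub>C 'a)"
  assumes A: "hille_yosida UNIV D A M_A \<omega>_A"
    and X0: "X0 = closure D"
    and F_ap: "almost_periodic {f. bounded_op X0 UNIV f} (op_dist X0) F"
    and V_ap: "almost_periodic {f. bounded_op X0 UNIV f} (op_dist X0) V"
    and cone_X: "normal_generating_cone UNIV Xpos"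
    and cone_X0: "normal_generating_cone X0 (X0 \<inter> Xpos)"
    and U: "solution_family D A (\<lambda>t x. F t x - V t x) U"
    and \<Gamma>: "solution_family D A (\<lambda>t x. - V t x) \<Gamma>"
    and B: "AP_resolvent_operator D A \<Gamma> DB B"
    and T: "C0_semigroup (AP X0) T"
    and T_gen: "is_generator (AP X0) T
      (part_domain DB (\<lambda>\<psi>. B \<psi> + mult_op F \<psi>) (AP X0)) (\<lambda>\<psi>. B \<psi> + mult_op F \<psi>)"
    and resolvent_pos: "\<exists>\<omega>. \<forall>\<kappa>>\<omega>. \<kappa> \<in> resolvent_set UNIV D A \<and>
      (\<forall>x\<in>Xpos. resolvent D A \<kappa> x \<in> Xpos)"
    and V_pos: "\<exists>\<kappa>1>\<omega>_A. \<forall>\<phi>\<in>X0 \<inter> Xpos. \<forall>t. \<kappa>1 *\<^sub>R \<phi> - V t \<phi> \<in> Xpos"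
    and F_pos: "\<forall>t. \<forall>\<phi>\<in>X0 \<inter> Xpos. F t \<phi> \<in> Xpos"
    and growth_neg: "growth_bound X0 \<Gamma> < 0"
    and \<Gamma>_ap: "\<forall>\<epsilon>>0. \<forall>\<nu>>0. \<exists>\<eta>>0. \<exists>\<delta><0.
      \<forall>t s. t \<ge> s \<and> t - s \<ge> \<nu> \<longrightarrow> (\<forall>\<tau>\<in>translation_set (op_dist X0) V \<eta>.
        op_dist X0 (\<Gamma> (t + \<tau>) (s + \<tau>)) (\<Gamma> t s) \<le> \<epsilon> * exp (\<delta> * (t - s)))"
  shows "\<forall>t\<ge>0. \<forall>s. \<forall>\<phi>\<in>AP X0.
    evolution_semigroup U t (apply_bcontfun \<phi>) s = apply_bcontfun (T t \<phi>) s"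
proof (intro allI impI ballI)
  fix t s :: real and \<phi> assume "0 \<le> t" and \<phi>: "\<phi> \<in> AP X0"
  define \<kappa> where "\<kappa> = \<omega>_A + 1"
  have \<kappa>: "\<kappa> \<in> resolvent_set UNIV D A"
    using A by (simp add: \<kappa>_def hille_yosida_def)
  note [simp] = X0
  interpret mild_evolution D A M_A \<omega>_A \<kappa> "\<lambda>t x. - V t x" \<Gamma>
    using A \<kappa> almost_periodic_op_uminus[OF V_ap] \<Gamma> by unfold_locales simp_all
  have B': "AP_resolvent_operator D A \<Gamma> DB B" and neg: "growth_bound (closure D) \<Gamma> < 0"
    using B growth_neg by simp_all
  have AP: "subspace (AP (closure D))" "closed (AP (closure D))"
    using AP_resolvent_operator_at_zero(3)[OF B' neg] subspace_X0
    by (auto intro: subspace_AP closed_AP)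
  let ?Dom = "part_domain DB (\<lambda>\<psi>. B \<psi> + mult_op F \<psi>) (AP (closure D))"
  have T': "C0_semigroup (AP (closure D)) T"
    and gen: "is_generator (AP (closure D)) T ?Dom (\<lambda>\<psi>. B \<psi> + mult_op F \<psi>)"
    using T T_gen by simp_all
  have T_bop: "bounded_op (AP (closure D)) (AP (closure D)) (T t)" if "0 \<le> t" for t
    using T' that by (simp add: C0_semigroup_def)
  define a where "a = s - t"
  have "a \<le> s"
    using \<open>0 \<le> t\<close> by (simp add: a_def)
  have on_domain: "U s a (apply_bcontfun \<psi> a) = apply_bcontfun (T t \<psi>) s" if \<psi>: "\<psi> \<in> ?Dom" for \<psi>
  proof -
    define u where "u r = apply_bcontfun (T (r - a) \<psi>) r" for r
    have \<psi>_AP: "\<psi> \<in> AP (closure D)"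
      using \<psi> by (simp add: part_domain_def)
    have u_mem: "u r \<in> closure D" if "r \<ge> a" for r
      unfolding u_def using that \<psi>_AP by (intro AP_in bounded_op_in[OF T_bop]) auto
    have u_cont: "continuous_on {a..} u"
      unfolding u_def using T' \<psi>_AP by (rule C0_semigroup_AP_diagonal_continuous_on)
    have F_cont: "continuous_on {a..} (\<lambda>r. F r (u r))" and V_cont: "continuous_on {a..} (\<lambda>r. V r (u r))"
      using F_ap V_ap u_mem by (auto intro!: almost_periodic_op_continuous_on[OF _ subspace_X0 u_cont])
    have u_a: "u a = apply_bcontfun \<psi> a"
      using T' \<psi>_AP by (simp add: u_def C0_semigroup_def)
    have "R (u r) - R (u a) = integral {a..r} (\<lambda>q. K q (u q) + R (F q (u q)))" if "a \<le> r" for r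
      using that
    proof (rule right_derivative_imp_integral)
      show "continuous_on {a..r} (\<lambda>q. R (u q))"
        by (intro R.continuous_on continuous_on_subset[OF u_cont]) auto
      show "continuous_on {a..r} (\<lambda>q. K q (u q) + R (F q (u q)))"
        by (intro continuous_intros R.continuous_on continuous_on_K
            continuous_on_subset[OF u_cont] continuous_on_subset[OF F_cont] u_mem) auto
      show "((\<lambda>h. (R (u (q + h)) - R (u q)) /\<^sub>R h) \<longlongrightarrow> K q (u q) + R (F q (u q))) (at_right 0)"
        if "a \<le> q" "q < r" for q
        unfolding u_def using AP_semigroup_right_derivative[OF B' neg T' AP(1) gen _ \<psi> that(1)] F_ap by simp
    qed
    moreover have "K q (u q) + R (F q (u q)) = \<kappa> *\<^sub>R R (u q) - u q + R (F q (u q) - V q (u q))" for q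
      by (simp add: K_def R.diff R.neg)
    ultimately have "mild_solution D A (\<lambda>t x. F t x - V t x) a (u a) u"
      by (subst mild_solution_iff[where G = "\<lambda>t x. F t x - V t x",
            OF \<kappa> u_cont u_mem continuous_on_diff[OF F_cont V_cont]])
         simp_all
    moreover have "mild_solution D A (\<lambda>t x. F t x - V t x) a (u a) u \<longleftrightarrow> (\<forall>t\<ge>a. u t = U t a (u a))"
      using U u_mem[of a] unfolding solution_family_def by blast
    ultimately have "u s = U s a (u a)"
      using \<open>a \<le> s\<close> by blast
    then show ?thesis
      by (simp add: u_a) (simp add: u_def a_def)
  qed
  have U_bop: "bounded_op (closure D) (closure D) (U s a)"
    using U \<open>a \<le> s\<close> by (simp add: solution_family_def evolution_family_def)
  have "\<phi> \<in> closure ?Dom"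
    using C0_semigroup_generator_dense[OF T' AP, where Dom = ?Dom, OF gen] \<phi> by auto
  then obtain \<psi> where \<psi>: "\<And>n. \<psi> n \<in> ?Dom" "\<psi> \<longlonglongrightarrow> \<phi>"
    unfolding closure_sequential by blast
  have \<psi>_AP: "\<psi> n \<in> AP (closure D)" for n
    using \<psi>(1)[of n] by (simp add: part_domain_def)
  have "(\<lambda>n. apply_bcontfun (T t (\<psi> n)) s) \<longlonglongrightarrow> apply_bcontfun (T t \<phi>) s"
    using \<phi> \<psi>_AP \<open>0 \<le> t\<close> by (intro tendsto_apply_bcontfun tendsto_const bounded_op_tendsto[OF T_bop AP(1) \<psi>(2)]) auto
  moreover have "(\<lambda>n. U s a (apply_bcontfun (\<psi> n) a)) \<longlonglongrightarrow> U s a (apply_bcontfun \<phi> a)"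
  proof (rule bounded_op_tendsto[OF U_bop subspace_X0])
    show "(\<lambda>n. apply_bcontfun (\<psi> n) a) \<longlonglongrightarrow> apply_bcontfun \<phi> a"
      by (intro tendsto_apply_bcontfun tendsto_const \<psi>(2))
  qed (use \<phi> \<psi>_AP in \<open>auto intro: AP_in always_eventually\<close>)
  ultimately have "U s a (apply_bcontfun \<phi> a) = apply_bcontfun (T t \<phi>) s"
    unfolding on_domain[OF \<psi>(1)] by (rule LIMSEQ_unique[THEN sym])
  then show "evolution_semigroup U t (apply_bcontfun \<phi>) s = apply_bcontfun (T t \<phi>) s"
    by (simp add: evolution_semigroup_def a_def)
qed

end
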